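(* Let $U$ be the unitary operator on $L^2(\mu_{\frac14})$ determined by $U(e_\gamma)=e_{5\gamma}$, $\gamma\in\Gamma$. Given $v\in L^2(\mu_{\frac14})$ with $\|v\|=1$, there is an isometric isomorphism between the $U$-cyclic subspace $H(v)$ and the Hilbert space $L^2(m_v)$.
   Context: $\mu_{\frac14}$ is the unique Borel probability measure on $\mathbb{R}$ satisfying $\mu_{\frac14}=\frac12\,\mu_{\frac14}\circ\tau_+^{-1}+\frac12\,\mu_{\frac14}\circ\tau_-^{-1}$, where $\tau_+(x)=\frac14(x+1)$ and $\tau_-(x)=\frac14(x-1)$. For $t\in\mathbb{R}$, $e_t(x)=e^{2\pi i t x}$. $\Gamma=\{\sum_{i=0}^m a_i4^i : a_i\in\{0,1\},\ m \text{ finite}\}$. It is known that both $\{e_\gamma:\gamma\in\Gamma\}$ and $\{e_{5\gamma}:\gamma\in\Gamma\}$ are orthonormal bases of $L^2(\mu_{\frac14})$, so $U(e_\gamma):=e_{5\gamma}$ ($\gamma\in\Gamma$) extends linearly and continuously to a unitary operator on $L^2(\mu_{\frac14})$. For $v\in L^2(\mu_{\frac14})$, the $U$-cyclic subspace $H(v)$ is the smallest closed subspace of $L^2(\mu_{\frac14})$ which contains $v$ and is invariant under both $U$ and $U^*=U^{-1}$. $E^U$ denotes the projection-valued spectral measure of $U$ on the Borel sets of the unit circle $\mathbb{T}$, so that $U=\int z\,E^U(dz)$. $m_v$ is the Borel measure on $\mathbb{T}$ given by $m_v(A)=\langle E^U(A)v,v\rangle_{L^2(\mu_{\frac14})}$;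 it is a probability measure when $\|v\|=1$. *)

theory Defs
  imports "HOL-Probability.Probability"
begin

section \<open>The Cantor measure of scale 1/4\<close>

definition tau_plus :: "real \<Rightarrow> real" where
  "tau_plus x = (1 / 4) * (x + 1)"

definition tau_minus :: "real \<Rightarrow> real" where
  "tau_minus x = (1 / 4) * (x - 1)"

definition quarter_invariant :: "real measure \<Rightarrow> bool" where
  "quarter_invariant m \<longleftrightarrow> prob_space m \<and> sets m = sets borel \<and>
     (\<forall>A \<in> sets borel. measure m A =
        (1 / 2) * measure (distr m borel tau_plus) A + (1 / 2) * measure (distr m borel tau_minus) A)"

text \<open>Existence and uniqueness of the measure described here is \<open>quarter_invariant_ex1\<close> below.\<close>

definition mu_quarter :: "real measure" where
  "mu_quarter = (THE m. quarter_invariant m)"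

context
begin

private definition sg :: "bool \<Rightarrow> real" where "sg b = (if b then 1 else - 1)"

private abbreviation "coin \<equiv> measure_pmf (bernoulli_pmf (1 / 2))"

private lemma distr_coin:
  assumes m: "prob_space m" "sets m = sets borel" and A: "A \<in> sets borel"
  shows "measure (distr (coin \<Otimes>\<^sub>M m) borel (\<lambda>(b, x). (sg b + x) / 4)) A =
    (1 / 2) * measure (distr m borel tau_plus) A + (1 / 2) * measure (distr m borel tau_minus) A"
proof -
  interpret m: prob_space m by fact
  interpret P: pair_prob_space coin m ..
  have [measurable_cong]: "sets m = sets borel" by fact
  have tp: "tau_plus \<in> borel_measurable m" "tau_minus \<in> borel_measurable m"
    unfolding tau_plus_def tau_minus_def by measurable
  have [measurable]: "sg \<in> borel_measurable coin" by simp
  let ?g = "(\<lambda>(b, x). (sg b + x) / 4)"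
  have g[measurable]: "?g \<in> borel_measurable (coin \<Otimes>\<^sub>M m)" by measurable
  have sp: "space m = UNIV" using sets_eq_imp_space_eq[OF m(2)] by simp
  have S: "?g -` A \<inter> space (coin \<Otimes>\<^sub>M m) \<in> sets (coin \<Otimes>\<^sub>M m)"
    using g A by (rule measurable_sets)
  have "emeasure (distr (coin \<Otimes>\<^sub>M m) borel ?g) A =
      (\<integral>\<^sup>+ b. emeasure m ((\<lambda>x. (sg b + x) / 4) -` A) \<partial>coin)"
    unfolding emeasure_distr[OF g A] m.emeasure_pair_measure_alt[OF S]
    by (intro nn_integral_cong arg_cong[where f="emeasure m"])
       (auto simp: sp space_pair_measure)
  also have "\<dots> = (\<integral>\<^sup>+ b. emeasure (distr m borel (if b then tau_plus else tau_minus)) A \<partial>coin)"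
  proof (rule nn_integral_cong)
    fix b
    have "(if b then tau_plus else tau_minus) = (\<lambda>x. (sg b + x) / 4)"
      by (auto simp: tau_plus_def tau_minus_def sg_def fun_eq_iff)
    then show "emeasure m ((\<lambda>x. (sg b + x) / 4) -` A) =
        emeasure (distr m borel (if b then tau_plus else tau_minus)) A"
      using tp A sp by (cases b) (simp_all add: emeasure_distr)
  qed
  also have "\<dots> = ennreal (1/2) * emeasure (distr m borel tau_plus) A
      + ennreal (1/2) * emeasure (distr m borel tau_minus) A"
    by (simp add: nn_integral_bernoulli_pmf mult.commute)
  also have "\<dots> = ennreal ((1 / 2) * measure (distr m borel tau_plus) A
      + (1 / 2) * measure (distr m borel tau_minus) A)"
    unfolding finite_measure.emeasure_eq_measure[OF m.finite_measure_distr[OF tp(1)]]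
      finite_measure.emeasure_eq_measure[OF m.finite_measure_distr[OF tp(2)]]
    by (subst ennreal_plus, simp, simp) (simp only: ennreal_mult'' measure_nonneg)
  finally show ?thesis
    by (intro measure_eq_emeasure_eq_ennreal) auto
qed

private lemma invariant_iff:
  assumes m: "prob_space m" "sets m = sets borel"
  shows "quarter_invariant m \<longleftrightarrow> distr (coin \<Otimes>\<^sub>M m) borel (\<lambda>(b, x). (sg b + x) / 4) = m"
    (is "_ \<longleftrightarrow> ?D = m")
proof -
  interpret m: prob_space m by fact
  interpret P: pair_prob_space coin m ..
  have [measurable_cong]: "sets m = sets borel" by fact
  have [measurable]: "sg \<in> borel_measurable coin" by simp
  have g[measurable]: "(\<lambda>(b, x). (sg b + x) / 4) \<in> borel_measurable (coin \<Otimes>\<^sub>M m)" by measurable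
  interpret D: prob_space ?D by (rule P.prob_space_distr) fact
  show ?thesis
  proof
    assume q: "quarter_invariant m"
    show "?D = m"
    proof (rule measure_eqI)
      fix A assume "A \<in> sets ?D"
      then have A: "A \<in> sets borel" by simp
      have "measure ?D A = measure m A"
        using distr_coin[OF m A] q A by (simp add: quarter_invariant_def)
      then show "emeasure ?D A = emeasure m A"
        by (simp add: D.emeasure_eq_measure m.emeasure_eq_measure)
    qed (simp add: m)
  next
    assume "?D = m"
    then show "quarter_invariant m"
      unfolding quarter_invariant_def using m distr_coin[OF m] by metis
  qed
qed

private lemma char_invariant:
  assumes "quarter_invariant m"
  shows "char m t = (\<integral>b. iexp (t / 4 * sg b) \<partial>coin) * char m (t / 4)"
proof -
  have m: "prob_space m" "sets m = sets borel" using assms by (auto simp: quarter_invariant_def)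
  interpret m: prob_space m by fact
  interpret P: pair_prob_space coin m ..
  have [measurable_cong]: "sets m = sets borel" by fact
  have [measurable]: "sg \<in> borel_measurable coin" by simp
  have g[measurable]: "(\<lambda>(b, x). (sg b + x) / 4) \<in> borel_measurable (coin \<Otimes>\<^sub>M m)" by measurable
  let ?f = "\<lambda>b x. iexp (t / 4 * sg b) * iexp (t / 4 * x)"
  have e: "iexp (t * ((sg b + x) / 4)) = ?f b x" for b x
    by (simp add: exp_add[symmetric] algebra_simps add_divide_distrib)
  have int: "integrable (coin \<Otimes>\<^sub>M m) (\<lambda>(b, x). ?f b x)"
    by (rule P.integrable_const_bound[where B=1]) (auto simp: norm_mult)
  have "char m t = char (distr (coin \<Otimes>\<^sub>M m) borel (\<lambda>(b, x). (sg b + x) / 4)) t"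
    using invariant_iff[OF m] assms by simp
  also have "\<dots> = (\<integral>z. (\<lambda>(b, x). ?f b x) z \<partial>(coin \<Otimes>\<^sub>M m))"
    unfolding char_def by (subst integral_distr) (auto simp only: e split_beta' g, measurable)
  also have "\<dots> = (\<integral>b. (\<integral>x. ?f b x \<partial>m) \<partial>coin)"
    by (rule P.integral_fst'[OF int, symmetric, simplified split_conv])
  also have "\<dots> = (\<integral>b. iexp (t / 4 * sg b) \<partial>coin) * char m (t / 4)"
    by (simp add: char_def)
  finally show ?thesis .
qed

private lemma invariant_unique:
  assumes "quarter_invariant m" "quarter_invariant m'"
  shows "m = m'"
proof (rule Levy_uniqueness)
  show rd: "real_distribution m" "real_distribution m'"
    using assms by (auto simp: quarter_invariant_def real_distribution_def
        real_distribution_axioms_def)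
  interpret m: real_distribution m by fact
  interpret m': real_distribution m' by fact
  have step: "cmod (char m t - char m' t) \<le> cmod (char m (t / 4) - char m' (t / 4))" for t
  proof -
    have "cmod (\<integral>b. iexp (t / 4 * sg b) \<partial>coin) \<le> (\<integral>b. cmod (iexp (t / 4 * sg b)) \<partial>coin)"
      by (rule integral_norm_bound)
    also have "\<dots> \<le> 1" by simp
    finally have "cmod (\<integral>b. iexp (t / 4 * sg b) \<partial>coin) \<le> 1" .
    then show ?thesis
      unfolding char_invariant[OF assms(1), of t] char_invariant[OF assms(2), of t]
        right_diff_distrib[symmetric] norm_mult
      by (rule mult_left_le_one_le[OF norm_ge_zero norm_ge_zero])
  qed
  show "char m = char m'"
  proof
    fix t
    have le: "cmod (char m t - char m' t) \<le> cmod (char m (t / 4 ^ n) - char m' (t / 4 ^ n))" for n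
    proof (induction n)
      case (Suc n)
      then show ?case using step[of "t / 4 ^ n"] by (simp add: mult.commute)
    qed simp
    have "(\<lambda>n. t / 4 ^ n) \<longlonglongrightarrow> 0"
      using tendsto_mult_right_zero[OF LIMSEQ_realpow_zero[of "1/4"], of t]
      by (simp add: power_one_over)
    then have "(\<lambda>n. cmod (char m (t / 4 ^ n) - char m' (t / 4 ^ n))) \<longlonglongrightarrow> cmod (char m 0 - char m' 0)"
      by (intro tendsto_intros isCont_tendsto_compose[OF m.isCont_char]
          isCont_tendsto_compose[OF m'.isCont_char])
    then have "(\<lambda>n. cmod (char m (t / 4 ^ n) - char m' (t / 4 ^ n))) \<longlonglongrightarrow> 0"
      by (simp add: m.char_zero m'.char_zero)
    then have "cmod (char m t - char m' t) \<le> 0"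
      by (rule LIMSEQ_le_const) (use le in blast)
    then show "char m t = char m' t" by simp
  qed
qed

private lemma invariant_exists: "\<exists>m. quarter_invariant m"
proof -
  interpret product_prob_space "\<lambda>i. coin" "UNIV :: nat set" ..
  interpret sequence_space coin ..
  have PS: "prob_space S" by (rule prob_space_PiM) (rule prob_space_measure_pmf)
  define X where "X = (\<lambda>\<omega>. \<Sum>k::nat. sg (\<omega> k) / 4 ^ Suc k)"
  have [measurable]: "sg \<in> borel_measurable coin" by simp
  have X[measurable]: "X \<in> borel_measurable S" unfolding X_def by measurable
  have sm: "summable (\<lambda>k. sg (\<omega> k) / 4 ^ Suc k)" for \<omega>
  proof (rule summable_comparison_test)
    show "\<exists>N. \<forall>n\<ge>N. norm (sg (\<omega> n) / 4 ^ Suc n) \<le> (1 / 4) ^ n"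
      by (auto simp: sg_def field_simps power_one_over)
    show "summable (\<lambda>n. (1 / 4 :: real) ^ n)" by simp
  qed
  have X_case: "X (case_nat b \<omega>) = (sg b + X \<omega>) / 4" for b \<omega>
  proof -
    have "X (case_nat b \<omega>) = (\<Sum>k. sg (\<omega> k) / 4 ^ Suc (Suc k)) + sg b / 4"
      unfolding X_def using suminf_split_head[OF sm[of "case_nat b \<omega>"]] by simp
    also have "(\<Sum>k. sg (\<omega> k) / 4 ^ Suc (Suc k)) = (\<Sum>k. sg (\<omega> k) / 4 ^ Suc k) / 4"
      by (subst suminf_divide[OF sm, symmetric]) (simp add: mult.commute)
    finally show ?thesis by (simp add: X_def add_divide_distrib)
  qed
  let ?m = "distr S borel X"
  have pm: "prob_space ?m" by (rule prob_space.prob_space_distr[OF PS X])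
  interpret m: prob_space ?m by fact
  have "distr (coin \<Otimes>\<^sub>M ?m) borel (\<lambda>(b, x). (sg b + x) / 4) = ?m"
  proof -
    have "coin \<Otimes>\<^sub>M ?m = distr coin coin (\<lambda>b. b) \<Otimes>\<^sub>M distr S borel X"
      by simp
    also have "\<dots> = distr (coin \<Otimes>\<^sub>M S) (coin \<Otimes>\<^sub>M borel) (\<lambda>(b, \<omega>). (b, X \<omega>))"
      by (rule pair_measure_distr) (auto intro: m.sigma_finite_measure_axioms)
    finally have "distr (coin \<Otimes>\<^sub>M ?m) borel (\<lambda>(b, x). (sg b + x) / 4) =
        distr (coin \<Otimes>\<^sub>M S) borel ((\<lambda>(b, x). (sg b + x) / 4) \<circ> (\<lambda>(b, \<omega>). (b, X \<omega>)))"
      by (simp only:) (subst distr_distr, measurable)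
    also have "\<dots> = distr (coin \<Otimes>\<^sub>M S) borel (X \<circ> (\<lambda>(s, \<omega>). case_nat s \<omega>))"
      by (rule arg_cong[where f="distr _ _"]) (auto simp: X_case fun_eq_iff)
    also have "\<dots> = distr (distr (coin \<Otimes>\<^sub>M S) S (\<lambda>(s, \<omega>). case_nat s \<omega>)) borel X"
      by (subst distr_distr) (auto simp: X)
    also have "\<dots> = ?m" by (simp only: PiM_iter)
    finally show ?thesis .
  qed
  then show ?thesis
    using invariant_iff[OF pm] by auto
qed

lemma quarter_invariant_ex1: "\<exists>!m. quarter_invariant m"
  using invariant_exists invariant_unique by blast

end

lemma quarter_invariant_mu_quarter: "quarter_invariant mu_quarter"
  unfolding mu_quarter_def by (rule theI'[OF quarter_invariant_ex1])


section \<open>Complex \<open>L\<^sup>2\<close> spaces\<close>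

text \<open>The elements of \<open>l2 M\<close> are almost-everywhere classes of square-integrable functions. The
  vector operations pick a representative with \<open>l2_rep\<close> and do not depend on that choice.\<close>

definition sq_integrable :: "'a measure \<Rightarrow> ('a \<Rightarrow> complex) set" where
  "sq_integrable M = {f \<in> borel_measurable M. integrable M (\<lambda>x. (cmod (f x))\<^sup>2)}"

definition ae_rel :: "'a measure \<Rightarrow> (('a \<Rightarrow> complex) \<times> ('a \<Rightarrow> complex)) set" where
  "ae_rel M = {(f, g). f \<in> sq_integrable M \<and> g \<in> sq_integrable M \<and> (AE x in M. f x = g x)}"

definition l2 :: "'a measure \<Rightarrow> ('a \<Rightarrow> complex) set set" where
  "l2 M = sq_integrable M // ae_rel M"

definition l2_class :: "'a measure \<Rightarrow> ('a \<Rightarrow> complex) \<Rightarrow> ('a \<Rightarrow> complex) set" where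
  "l2_class M f = ae_rel M `` {f}"

definition l2_rep :: "('a \<Rightarrow> complex) set \<Rightarrow> 'a \<Rightarrow> complex" where
  "l2_rep F = (SOME f. f \<in> F)"

definition l2_zero :: "'a measure \<Rightarrow> ('a \<Rightarrow> complex) set" where
  "l2_zero M = l2_class M (\<lambda>x. 0)"

definition l2_add :: "'a measure \<Rightarrow> ('a \<Rightarrow> complex) set \<Rightarrow> ('a \<Rightarrow> complex) set \<Rightarrow> ('a \<Rightarrow> complex) set" where
  "l2_add M F G = l2_class M (\<lambda>x. l2_rep F x + l2_rep G x)"

definition l2_scale :: "'a measure \<Rightarrow> complex \<Rightarrow> ('a \<Rightarrow> complex) set \<Rightarrow> ('a \<Rightarrow> complex) set" where
  "l2_scale M c F = l2_class M (\<lambda>x. c * l2_rep F x)"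

definition l2_sum :: "'a measure \<Rightarrow> ('i \<Rightarrow> ('a \<Rightarrow> complex) set) \<Rightarrow> 'i set \<Rightarrow> ('a \<Rightarrow> complex) set" where
  "l2_sum M F I = l2_class M (\<lambda>x. \<Sum>i\<in>I. l2_rep (F i) x)"

definition l2_inner :: "'a measure \<Rightarrow> ('a \<Rightarrow> complex) set \<Rightarrow> ('a \<Rightarrow> complex) set \<Rightarrow> complex" where
  "l2_inner M F G = (\<integral>x. l2_rep F x * cnj (l2_rep G x) \<partial>M)"

definition l2_norm :: "'a measure \<Rightarrow> ('a \<Rightarrow> complex) set \<Rightarrow> real" where
  "l2_norm M F = sqrt (Re (l2_inner M F F))"

definition l2_dist :: "'a measure \<Rightarrow> ('a \<Rightarrow> complex) set \<Rightarrow> ('a \<Rightarrow> complex) set \<Rightarrow> real" where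
  "l2_dist M F G = sqrt (\<integral>x. (cmod (l2_rep F x - l2_rep G x))\<^sup>2 \<partial>M)"

definition l2_topology :: "'a measure \<Rightarrow> ('a \<Rightarrow> complex) set topology" where
  "l2_topology M = Metric_space.mtopology (l2 M) (l2_dist M)"


section \<open>Subspaces and operators\<close>

definition closed_l2_subspace :: "'a measure \<Rightarrow> ('a \<Rightarrow> complex) set set \<Rightarrow> bool" where
  "closed_l2_subspace M S \<longleftrightarrow> S \<subseteq> l2 M \<and> l2_zero M \<in> S \<and>
     (\<forall>F\<in>S. \<forall>G\<in>S. l2_add M F G \<in> S) \<and> (\<forall>c. \<forall>F\<in>S. l2_scale M c F \<in> S) \<and>
     closedin (l2_topology M) S"

definition l2_linear_on ::
  "'a measure \<Rightarrow> 'b measure \<Rightarrow> ('a \<Rightarrow> complex) set set \<Rightarrow>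
    (('a \<Rightarrow> complex) set \<Rightarrow> ('b \<Rightarrow> complex) set) \<Rightarrow> bool" where
  "l2_linear_on M N S T \<longleftrightarrow> (\<forall>F\<in>S. T F \<in> l2 N) \<and>
     (\<forall>F\<in>S. \<forall>G\<in>S. T (l2_add M F G) = l2_add N (T F) (T G)) \<and>
     (\<forall>c. \<forall>F\<in>S. T (l2_scale M c F) = l2_scale N c (T F))"

definition unitary_l2 :: "'a measure \<Rightarrow> (('a \<Rightarrow> complex) set \<Rightarrow> ('a \<Rightarrow> complex) set) \<Rightarrow> bool" where
  "unitary_l2 M U \<longleftrightarrow> l2_linear_on M M (l2 M) U \<and> bij_betw U (l2 M) (l2 M) \<and>
     (\<forall>F\<in>l2 M. \<forall>G\<in>l2 M. l2_inner M (U F) (U G) = l2_inner M F G)"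

definition orth_projection_l2 :: "'a measure \<Rightarrow> (('a \<Rightarrow> complex) set \<Rightarrow> ('a \<Rightarrow> complex) set) \<Rightarrow> bool" where
  "orth_projection_l2 M P \<longleftrightarrow> l2_linear_on M M (l2 M) P \<and> (\<forall>F\<in>l2 M. P (P F) = P F) \<and>
     (\<forall>F\<in>l2 M. \<forall>G\<in>l2 M. l2_inner M (P F) G = l2_inner M F (P G))"

text \<open>For a unitary \<open>U\<close> the adjoint is the inverse of \<open>U\<close> on \<open>l2 M\<close>.\<close>

definition cyclic_subspace ::
  "'a measure \<Rightarrow> (('a \<Rightarrow> complex) set \<Rightarrow> ('a \<Rightarrow> complex) set) \<Rightarrow> ('a \<Rightarrow> complex) set \<Rightarrow>
    ('a \<Rightarrow> complex) set set" where
  "cyclic_subspace M U v =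
     \<Inter> {S. closed_l2_subspace M S \<and> v \<in> S \<and> U ` S \<subseteq> S \<and> inv_into (l2 M) U ` S \<subseteq> S}"

text \<open>Isometric isomorphism of a subspace of \<open>l2 M\<close> onto all of \<open>l2 N\<close>.\<close>

definition l2_isometric_iso ::
  "'a measure \<Rightarrow> ('a \<Rightarrow> complex) set set \<Rightarrow> 'b measure \<Rightarrow>
    (('a \<Rightarrow> complex) set \<Rightarrow> ('b \<Rightarrow> complex) set) \<Rightarrow> bool" where
  "l2_isometric_iso M S N T \<longleftrightarrow> l2_linear_on M N S T \<and> bij_betw T S (l2 N) \<and>
     (\<forall>F\<in>S. l2_norm N (T F) = l2_norm M F)"


section \<open>Spectral measures on the unit circle\<close>

definition circle_borel :: "complex measure" where
  "circle_borel = restrict_space borel (sphere 0 1)"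

definition projection_valued_measure ::
  "'a measure \<Rightarrow> (complex set \<Rightarrow> ('a \<Rightarrow> complex) set \<Rightarrow> ('a \<Rightarrow> complex) set) \<Rightarrow> bool" where
  "projection_valued_measure M E \<longleftrightarrow>
     (\<forall>A\<in>sets circle_borel. orth_projection_l2 M (E A)) \<and>
     (\<forall>F\<in>l2 M. E {} F = l2_zero M \<and> E (sphere 0 1) F = F) \<and>
     (\<forall>A\<in>sets circle_borel. \<forall>B\<in>sets circle_borel. \<forall>F\<in>l2 M. E (A \<inter> B) F = E A (E B F)) \<and>
     (\<forall>A :: nat \<Rightarrow> complex set. range A \<subseteq> sets circle_borel \<longrightarrow> disjoint_family A \<longrightarrow>
        (\<forall>F\<in>l2 M. limitin (l2_topology M) (\<lambda>n. l2_sum M (\<lambda>i. E (A i) F) {..<n})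
                     (E (\<Union>i. A i) F) sequentially))"

text \<open>\<open>\<integral> s dE\<close> for a simple function \<open>s\<close> on the circle, applied to the vector \<open>F\<close>.\<close>

definition pvm_simple_integral ::
  "'a measure \<Rightarrow> (complex set \<Rightarrow> ('a \<Rightarrow> complex) set \<Rightarrow> ('a \<Rightarrow> complex) set) \<Rightarrow>
    (complex \<Rightarrow> complex) \<Rightarrow> ('a \<Rightarrow> complex) set \<Rightarrow> ('a \<Rightarrow> complex) set" where
  "pvm_simple_integral M E s F =
     l2_sum M (\<lambda>c. l2_scale M c (E (s -` {c} \<inter> sphere 0 1) F)) (s ` sphere 0 1)"

text \<open>\<open>V = \<integral> f dE\<close> for a bounded Borel function \<open>f\<close> on the circle. Since the integral of simple
  functions is bounded by the supremum norm, the limit does not depend on the approximating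
  sequence, and strong convergence here implies convergence in operator norm.\<close>

definition has_pvm_integral ::
  "'a measure \<Rightarrow> (complex set \<Rightarrow> ('a \<Rightarrow> complex) set \<Rightarrow> ('a \<Rightarrow> complex) set) \<Rightarrow>
    (complex \<Rightarrow> complex) \<Rightarrow> (('a \<Rightarrow> complex) set \<Rightarrow> ('a \<Rightarrow> complex) set) \<Rightarrow> bool" where
  "has_pvm_integral M E f V \<longleftrightarrow>
     (\<exists>s :: nat \<Rightarrow> complex \<Rightarrow> complex. (\<forall>n. simple_function circle_borel (s n)) \<and>
        uniform_limit (sphere 0 1) s f sequentially \<and>
        (\<forall>F\<in>l2 M. limitin (l2_topology M) (\<lambda>n. pvm_simple_integral M E (s n) F) (V F) sequentially))"

definition is_spectral_measure ::
  "'a measure \<Rightarrow> (('a \<Rightarrow> complex) set \<Rightarrow> ('a \<Rightarrow> complex) set) \<Rightarrow>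
    (complex set \<Rightarrow> ('a \<Rightarrow> complex) set \<Rightarrow> ('a \<Rightarrow> complex) set) \<Rightarrow> bool" where
  "is_spectral_measure M U E \<longleftrightarrow>
     projection_valued_measure M E \<and> has_pvm_integral M E (\<lambda>z. z) U"

text \<open>\<open>\<langle>E(A) v, v\<rangle>\<close> is real and nonnegative because \<open>E(A)\<close> is an orthogonal projection, so
  passing to \<open>Re\<close> and \<open>ennreal\<close> loses nothing.\<close>

definition scalar_spectral_measure ::
  "'a measure \<Rightarrow> (complex set \<Rightarrow> ('a \<Rightarrow> complex) set \<Rightarrow> ('a \<Rightarrow> complex) set) \<Rightarrow>
    ('a \<Rightarrow> complex) set \<Rightarrow> complex measure" where
  "scalar_spectral_measure M E v =
     measure_of (sphere 0 1) (sets circle_borel) (\<lambda>A. ennreal (Re (l2_inner M (E A v) v)))"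


section \<open>The exponentials and the operator scaling the spectrum by 5\<close>

definition e_fun :: "real \<Rightarrow> (real \<Rightarrow> complex) set" where
  "e_fun t = l2_class mu_quarter (\<lambda>x. exp (2 * of_real pi * \<i> * of_real t * of_real x))"

definition Gamma_set :: "nat set" where
  "Gamma_set = {\<Sum>i\<le>m. a i * 4 ^ i | (a :: nat \<Rightarrow> nat) m. \<forall>i\<le>m. a i \<in> {0, 1}}"

definition is_scaling_by_5 :: "((real \<Rightarrow> complex) set \<Rightarrow> (real \<Rightarrow> complex) set) \<Rightarrow> bool" where
  "is_scaling_by_5 U \<longleftrightarrow> unitary_l2 mu_quarter U \<and>
     (\<forall>\<gamma>\<in>Gamma_set. U (e_fun (real \<gamma>)) = e_fun (5 * real \<gamma>))"

end

theory Submission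
  imports Defs
begin

text \<open>
  This is the cyclic form of the spectral theorem. Let \<open>m\<close> be the scalar measure
  \<open>m(A) = \<langle>E(A) v, v\<rangle>\<close>. The isomorphism is the inverse of the map \<open>f \<mapsto> f(U) v\<close> from \<open>L\<^sup>2(m)\<close> to the
  ambient space. For a simple function \<open>s\<close> the vector \<open>s(U) v\<close> is the sum of \<open>c E(s = c) v\<close> over the
  values \<open>c\<close> of \<open>s\<close>. Since the projections multiply like indicator functions,
  \<open>\<langle>s(U) v, t(U) v\<rangle>\<close> is the integral of \<open>s cnj t\<close> with respect to \<open>m\<close> (lemma \<open>inner_I_I\<close>). So the map
  preserves inner products on simple functions, which are dense, and extends to all of \<open>L\<^sup>2(m)\<close> because
  the target is complete (lemmas \<open>extend_isometry\<close> and \<open>fn_norm_complete\<close>).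

  It remains to identify the range. Because the spectral integral of the identity is \<open>U\<close>, the
  extended map carries multiplication by \<open>z\<close> to \<open>U\<close> and multiplication by \<open>cnj z\<close> to the inverse of \<open>U\<close>
  (lemmas \<open>U_fun_calc\<close> and \<open>U_inv_fun_calc\<close>). The range is closed since \<open>L\<^sup>2(m)\<close> is complete, it contains
  \<open>v\<close> as the image of 1, and it is invariant; so it contains the cyclic subspace. On the other hand,
  the preimage of any closed invariant subspace that contains \<open>v\<close> is a closed subspace of \<open>L\<^sup>2(m)\<close> that
  contains 1 and is stable under multiplication by \<open>z\<close> and \<open>cnj z\<close>. It contains all trigonometric
  polynomials and is therefore everything (lemma \<open>sq_integrable_circle_dense\<close>).
\<close>

section \<open>The seminormed space of square-integrable functions\<close>

text \<open>Analysis is done on functions, where sums and pointwise limits are literal; the passage to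
  classes comes afterwards. For a class, \<^const>\<open>l2_inner\<close> and \<^const>\<open>l2_dist\<close> are by definition the two
  quantities below evaluated at representatives.\<close>

definition fn_inner :: "'a measure \<Rightarrow> ('a \<Rightarrow> complex) \<Rightarrow> ('a \<Rightarrow> complex) \<Rightarrow> complex" where
  "fn_inner M f g = (\<integral>x. f x * cnj (g x) \<partial>M)"

definition fn_norm :: "'a measure \<Rightarrow> ('a \<Rightarrow> complex) \<Rightarrow> real" where
  "fn_norm M f = sqrt (\<integral>x. (cmod (f x))\<^sup>2 \<partial>M)"

lemma borel_measurable_cnj [measurable (raw)]:
  "f \<in> borel_measurable M \<Longrightarrow> (\<lambda>x. cnj (f x)) \<in> borel_measurable M"
  by (rule borel_measurable_continuous_on[where f=cnj]) (auto intro: continuous_intros)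

lemma sq_integrableD:
  assumes "f \<in> sq_integrable M"
  shows "f \<in> borel_measurable M" "integrable M (\<lambda>x. (cmod (f x))\<^sup>2)"
  using assms by (auto simp: sq_integrable_def)

lemma integrable_cmod_mult:
  assumes "f \<in> sq_integrable M" "g \<in> sq_integrable M"
  shows "integrable M (\<lambda>x. cmod (f x) * cmod (g x))"
proof (rule Bochner_Integration.integrable_bound)
  note [measurable] = sq_integrableD(1)[OF assms(1)] sq_integrableD(1)[OF assms(2)]
  show "integrable M (\<lambda>x. (cmod (f x))\<^sup>2 + (cmod (g x))\<^sup>2)"
    using assms by (intro Bochner_Integration.integrable_add sq_integrableD)
  show "(\<lambda>x. cmod (f x) * cmod (g x)) \<in> borel_measurable M" by measurable
  show "AE x in M. norm (cmod (f x) * cmod (g x)) \<le> norm ((cmod (f x))\<^sup>2 + (cmod (g x))\<^sup>2)"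
  proof (rule AE_I2)
    fix x
    have "0 \<le> (cmod (f x) - cmod (g x))\<^sup>2 + (cmod (f x) * cmod (f x) + cmod (g x) * cmod (g x))"
      by simp
    then show "norm (cmod (f x) * cmod (g x)) \<le> norm ((cmod (f x))\<^sup>2 + (cmod (g x))\<^sup>2)"
      by (simp add: power2_eq_square algebra_simps)
  qed
qed

lemma integrable_fn_inner:
  assumes "f \<in> sq_integrable M" "g \<in> sq_integrable M"
  shows "integrable M (\<lambda>x. f x * cnj (g x))"
proof (rule Bochner_Integration.integrable_bound[OF integrable_cmod_mult[OF assms]])
  note [measurable] = sq_integrableD(1)[OF assms(1)] sq_integrableD(1)[OF assms(2)]
  show "(\<lambda>x. f x * cnj (g x)) \<in> borel_measurable M" by measurable
qed (simp add: norm_mult)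

lemma sq_integrable_zero: "(\<lambda>x. 0) \<in> sq_integrable M"
  by (simp add: sq_integrable_def)

lemma sq_integrable_add:
  assumes "f \<in> sq_integrable M" "g \<in> sq_integrable M"
  shows "(\<lambda>x. f x + g x) \<in> sq_integrable M"
proof -
  note [measurable] = sq_integrableD(1)[OF assms(1)] sq_integrableD(1)[OF assms(2)]
  have "integrable M (\<lambda>x. (cmod (f x + g x))\<^sup>2)"
  proof (rule Bochner_Integration.integrable_bound)
    show "integrable M (\<lambda>x. (cmod (f x))\<^sup>2 + (cmod (g x))\<^sup>2 + 2 * (cmod (f x) * cmod (g x)))"
      using assms integrable_cmod_mult[OF assms]
      by (intro Bochner_Integration.integrable_add integrable_mult_right sq_integrableD)
    show "AE x in M. norm ((cmod (f x + g x))\<^sup>2)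
        \<le> norm ((cmod (f x))\<^sup>2 + (cmod (g x))\<^sup>2 + 2 * (cmod (f x) * cmod (g x)))"
    proof (rule AE_I2)
      fix x
      have "(cmod (f x + g x))\<^sup>2 \<le> (cmod (f x) + cmod (g x))\<^sup>2"
        by (intro power_mono norm_triangle_ineq norm_ge_zero)
      then show "norm ((cmod (f x + g x))\<^sup>2)
          \<le> norm ((cmod (f x))\<^sup>2 + (cmod (g x))\<^sup>2 + 2 * (cmod (f x) * cmod (g x)))"
        by (simp add: power2_eq_square algebra_simps)
    qed
  qed measurable
  then show ?thesis by (simp add: sq_integrable_def)
qed

lemma sq_integrable_scale:
  assumes "f \<in> sq_integrable M"
  shows "(\<lambda>x. c * f x) \<in> sq_integrable M"
  using assms by (auto simp: sq_integrable_def norm_mult power_mult_distrib)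

lemma sq_integrable_diff:
  assumes "f \<in> sq_integrable M" "g \<in> sq_integrable M"
  shows "(\<lambda>x. f x - g x) \<in> sq_integrable M"
  using sq_integrable_add[OF assms(1) sq_integrable_scale[OF assms(2), of "-1"]] by simp

lemma sq_integrable_sum:
  assumes "\<And>i. i \<in> I \<Longrightarrow> f i \<in> sq_integrable M"
  shows "(\<lambda>x. \<Sum>i\<in>I. f i x) \<in> sq_integrable M"
  using assms
  by (induction I rule: infinite_finite_induct) (auto intro: sq_integrable_zero sq_integrable_add)

lemma (in finite_measure) bounded_sq_integrable:
  assumes [measurable]: "f \<in> borel_measurable M" and "\<And>x. x \<in> space M \<Longrightarrow> cmod (f x) \<le> B"
  shows "f \<in> sq_integrable M"
proof -
  have "integrable M (\<lambda>x. (cmod (f x))\<^sup>2)"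
    by (rule integrable_const_bound[where B="B\<^sup>2"]) (use assms(2) in \<open>auto intro!: power_mono\<close>)
  then show ?thesis by (simp add: sq_integrable_def)
qed

lemma fn_norm_nonneg [simp]: "0 \<le> fn_norm M f"
  by (simp add: fn_norm_def)

lemma fn_norm_sq: "(fn_norm M f)\<^sup>2 = (\<integral>x. (cmod (f x))\<^sup>2 \<partial>M)"
  by (simp add: fn_norm_def)

lemma fn_inner_self: "fn_inner M f f = of_real ((fn_norm M f)\<^sup>2)"
  unfolding fn_inner_def fn_norm_sq complex_norm_square[symmetric] integral_complex_of_real ..

lemma fn_inner_add_left:
  assumes "f \<in> sq_integrable M" "g \<in> sq_integrable M" "h \<in> sq_integrable M"
  shows "fn_inner M (\<lambda>x. f x + g x) h = fn_inner M f h + fn_inner M g h"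
  using assms by (simp add: fn_inner_def algebra_simps integrable_fn_inner)

lemma fn_inner_scale_left: "fn_inner M (\<lambda>x. c * f x) h = c * fn_inner M f h"
  by (simp add: fn_inner_def mult.assoc)

lemma fn_inner_commute: "fn_inner M g f = cnj (fn_inner M f g)"
  unfolding fn_inner_def by (subst Bochner_Integration.integral_cnj[symmetric]) (simp add: mult.commute)

lemma fn_inner_diff_left:
  assumes "f \<in> sq_integrable M" "g \<in> sq_integrable M" "h \<in> sq_integrable M"
  shows "fn_inner M (\<lambda>x. f x - g x) h = fn_inner M f h - fn_inner M g h"
  using assms by (simp add: fn_inner_def algebra_simps integrable_fn_inner)

lemma fn_inner_diff_right:
  assumes "f \<in> sq_integrable M" "g \<in> sq_integrable M" "h \<in> sq_integrable M"
  shows "fn_inner M h (\<lambda>x. f x - g x) = fn_inner M h f - fn_inner M h g"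
  using fn_inner_diff_left[OF assms] fn_inner_commute[of M h] by simp

lemma fn_inner_sum_left:
  assumes "\<And>i. i \<in> I \<Longrightarrow> f i \<in> sq_integrable M" "h \<in> sq_integrable M"
  shows "fn_inner M (\<lambda>x. \<Sum>i\<in>I. f i x) h = (\<Sum>i\<in>I. fn_inner M (f i) h)"
  unfolding fn_inner_def sum_distrib_right
  by (rule Bochner_Integration.integral_sum) (use assms integrable_fn_inner in blast)

lemma fn_inner_cong_AE:
  assumes "f \<in> sq_integrable M" "f' \<in> sq_integrable M" "g \<in> sq_integrable M" "g' \<in> sq_integrable M"
    and "AE x in M. f x = f' x" "AE x in M. g x = g' x"
  shows "fn_inner M f g = fn_inner M f' g'"
proof -
  note [measurable] = assms(1-4)[THEN sq_integrableD(1)]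
  show ?thesis
    unfolding fn_inner_def
    by (rule integral_cong_AE; (measurable)?) (use assms(5,6) in \<open>auto elim: eventually_elim2\<close>)
qed

lemma fn_norm_cong_AE:
  assumes "f \<in> sq_integrable M" "f' \<in> sq_integrable M" "AE x in M. f x = f' x"
  shows "fn_norm M f = fn_norm M f'"
proof -
  note [measurable] = assms(1-2)[THEN sq_integrableD(1)]
  show ?thesis
    unfolding fn_norm_def
    by (rule arg_cong[where f=sqrt], rule integral_cong_AE; (measurable)?)
       (use assms(3) in \<open>auto elim: eventually_mono\<close>)
qed

lemma fn_norm_eq_0_iff:
  assumes "f \<in> sq_integrable M"
  shows "fn_norm M f = 0 \<longleftrightarrow> (AE x in M. f x = 0)"
  using integral_nonneg_eq_0_iff_AE[OF sq_integrableD(2)[OF assms]] by (simp add: fn_norm_def)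

lemma fn_norm_commute: "fn_norm M (\<lambda>x. f x - g x) = fn_norm M (\<lambda>x. g x - f x)"
  by (simp add: fn_norm_def norm_minus_commute)

text \<open>The sharper form of the Cauchy-Schwarz inequality, with the absolute value inside the
  integral: the triangle inequality and the bound of the \<open>L\<^sup>1\<close> norm by the \<open>L\<^sup>2\<close> norm both need it.\<close>

lemma integral_cmod_mult_le:
  assumes "f \<in> sq_integrable M" "g \<in> sq_integrable M"
  shows "(\<integral>x. cmod (f x) * cmod (g x) \<partial>M) \<le> fn_norm M f * fn_norm M g"
proof -
  note [measurable] = assms(1,2)[THEN sq_integrableD(1)]
  let ?I = "\<integral>x. cmod (f x) * cmod (g x) \<partial>M"
  have "ennreal (?I\<^sup>2) = (\<integral>\<^sup>+x. ennreal (cmod (f x)) * ennreal (cmod (g x)) \<partial>M)\<^sup>2"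
    using integrable_cmod_mult[OF assms]
    by (simp add: ennreal_power[symmetric] ennreal_mult[symmetric] nn_integral_eq_integral)
  also have "\<dots> \<le> (\<integral>\<^sup>+x. ennreal (cmod (f x)) ^ 2 \<partial>M) * (\<integral>\<^sup>+x. ennreal (cmod (g x)) ^ 2 \<partial>M)"
    by (rule Cauchy_Schwarz_nn_integral) measurable
  also have "\<dots> = ennreal ((fn_norm M f * fn_norm M g)\<^sup>2)"
    using assms[THEN sq_integrableD(2)]
    by (simp add: ennreal_power nn_integral_eq_integral ennreal_mult[symmetric] power_mult_distrib fn_norm_sq)
  finally have "?I\<^sup>2 \<le> (fn_norm M f * fn_norm M g)\<^sup>2"
    by (simp add: ennreal_le_iff)
  then show ?thesis
    by (rule power2_le_imp_le) simp
qed

lemma fn_inner_Cauchy_Schwarz: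
  assumes "f \<in> sq_integrable M" "g \<in> sq_integrable M"
  shows "cmod (fn_inner M f g) \<le> fn_norm M f * fn_norm M g"
proof -
  have "cmod (fn_inner M f g) \<le> (\<integral>x. cmod (f x * cnj (g x)) \<partial>M)"
    unfolding fn_inner_def by (rule integral_norm_bound)
  also have "\<dots> = (\<integral>x. cmod (f x) * cmod (g x) \<partial>M)" by (simp add: norm_mult)
  finally show ?thesis using integral_cmod_mult_le[OF assms] by linarith
qed

lemma fn_norm_triangle:
  assumes f: "f \<in> sq_integrable M" and g: "g \<in> sq_integrable M"
  shows "fn_norm M (\<lambda>x. f x + g x) \<le> fn_norm M f + fn_norm M g"
proof -
  have "(fn_norm M (\<lambda>x. f x + g x))\<^sup>2
      \<le> (\<integral>x. (cmod (f x))\<^sup>2 + (cmod (g x))\<^sup>2 + 2 * (cmod (f x) * cmod (g x)) \<partial>M)"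
    unfolding fn_norm_sq
  proof (rule integral_mono)
    show "integrable M (\<lambda>x. (cmod (f x + g x))\<^sup>2)"
      using sq_integrable_add[OF f g] by (rule sq_integrableD)
    show "integrable M (\<lambda>x. (cmod (f x))\<^sup>2 + (cmod (g x))\<^sup>2 + 2 * (cmod (f x) * cmod (g x)))"
      using f g integrable_cmod_mult[OF f g]
      by (intro Bochner_Integration.integrable_add integrable_mult_right sq_integrableD)
    fix x
    have "(cmod (f x + g x))\<^sup>2 \<le> (cmod (f x) + cmod (g x))\<^sup>2"
      by (intro power_mono norm_triangle_ineq norm_ge_zero)
    then show "(cmod (f x + g x))\<^sup>2 \<le> (cmod (f x))\<^sup>2 + (cmod (g x))\<^sup>2 + 2 * (cmod (f x) * cmod (g x))"
      by (simp add: power2_eq_square algebra_simps)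
  qed
  also have "\<dots> = (fn_norm M f)\<^sup>2 + (fn_norm M g)\<^sup>2 + 2 * (\<integral>x. cmod (f x) * cmod (g x) \<partial>M)"
    using f g integrable_cmod_mult[OF f g] by (simp add: fn_norm_sq sq_integrableD)
  also have "\<dots> \<le> (fn_norm M f + fn_norm M g)\<^sup>2"
    using integral_cmod_mult_le[OF f g] by (simp add: power2_eq_square algebra_simps)
  finally show ?thesis by (rule power2_le_imp_le) simp
qed

lemma fn_norm_triangle_diff:
  assumes "f \<in> sq_integrable M" "g \<in> sq_integrable M" "h \<in> sq_integrable M"
  shows "fn_norm M (\<lambda>x. f x - h x) \<le> fn_norm M (\<lambda>x. f x - g x) + fn_norm M (\<lambda>x. g x - h x)"
  using fn_norm_triangle[OF sq_integrable_diff[OF assms(1,2)] sq_integrable_diff[OF assms(2,3)]] by simp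

lemma fn_inner_tendsto:
  assumes f: "f \<in> sq_integrable M" and g: "g \<in> sq_integrable M"
    and fn: "\<And>n. fn n \<in> sq_integrable M" and gn: "\<And>n. gn n \<in> sq_integrable M"
    and lf: "(\<lambda>n. fn_norm M (\<lambda>x. fn n x - f x)) \<longlonglongrightarrow> 0"
    and lg: "(\<lambda>n. fn_norm M (\<lambda>x. gn n x - g x)) \<longlonglongrightarrow> 0"
  shows "(\<lambda>n. fn_inner M (fn n) (gn n)) \<longlonglongrightarrow> fn_inner M f g"
proof (rule LIM_zero_cancel, rule Lim_null_comparison)
  let ?a = "\<lambda>n. fn_norm M (\<lambda>x. fn n x - f x)" and ?b = "\<lambda>n. fn_norm M (\<lambda>x. gn n x - g x)"
  have "cmod (fn_inner M (fn n) (gn n) - fn_inner M f g) \<le> ?a n * (?b n + fn_norm M g) + fn_norm M f * ?b n"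
    for n
  proof -
    have "fn_inner M (fn n) (gn n) - fn_inner M f g =
        fn_inner M (\<lambda>x. fn n x - f x) (gn n) + fn_inner M f (\<lambda>x. gn n x - g x)"
      by (simp add: fn_inner_diff_left fn_inner_diff_right f g fn gn)
    also have "cmod \<dots> \<le> ?a n * fn_norm M (gn n) + fn_norm M f * ?b n"
      by (intro norm_triangle_mono fn_inner_Cauchy_Schwarz sq_integrable_diff f g fn gn)
    also have "fn_norm M (gn n) \<le> ?b n + fn_norm M g"
      using fn_norm_triangle[OF sq_integrable_diff[OF gn[of n] g] g] by simp
    finally show ?thesis by (simp add: mult_left_mono)
  qed
  then show "\<forall>\<^sub>F n in sequentially. cmod (fn_inner M (fn n) (gn n) - fn_inner M f g)
      \<le> ?a n * (?b n + fn_norm M g) + fn_norm M f * ?b n" by simp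
  have "(\<lambda>n. ?a n * (?b n + fn_norm M g) + fn_norm M f * ?b n) \<longlonglongrightarrow> 0 * (0 + fn_norm M g) + fn_norm M f * 0"
    by (intro tendsto_intros lf lg)
  then show "(\<lambda>n. ?a n * (?b n + fn_norm M g) + fn_norm M f * ?b n) \<longlonglongrightarrow> 0" by simp
qed

lemma fn_norm_dominated:
  assumes f: "f \<in> borel_measurable M" and s: "\<And>n. s n \<in> borel_measurable M"
    and w: "integrable M w"
    and lim: "\<And>x. x \<in> space M \<Longrightarrow> (\<lambda>n. s n x) \<longlonglongrightarrow> f x"
    and bound: "\<And>n x. x \<in> space M \<Longrightarrow> (cmod (s n x - f x))\<^sup>2 \<le> w x"
  shows "(\<lambda>n. fn_norm M (\<lambda>x. s n x - f x)) \<longlonglongrightarrow> 0"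
proof -
  note [measurable] = f s
  have "(\<lambda>n. \<integral>x. (cmod (s n x - f x))\<^sup>2 \<partial>M) \<longlonglongrightarrow> (\<integral>x. 0 \<partial>M)"
  proof (rule integral_dominated_convergence[OF _ _ w])
    show "AE x in M. (\<lambda>n. (cmod (s n x - f x))\<^sup>2) \<longlonglongrightarrow> 0"
    proof (rule AE_I2)
      fix x assume "x \<in> space M"
      then have "(\<lambda>n. (cmod (s n x - f x))\<^sup>2) \<longlonglongrightarrow> (cmod (f x - f x))\<^sup>2"
        by (intro tendsto_intros lim)
      then show "(\<lambda>n. (cmod (s n x - f x))\<^sup>2) \<longlonglongrightarrow> 0" by simp
    qed
  qed (use bound in auto)
  then have "(\<lambda>n. sqrt (\<integral>x. (cmod (s n x - f x))\<^sup>2 \<partial>M)) \<longlonglongrightarrow> sqrt (\<integral>x. 0 \<partial>M)"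
    by (rule tendsto_real_sqrt)
  then show ?thesis by (simp add: fn_norm_def)
qed

text \<open>The approximating simple functions may be chosen below twice the modulus of the limit, so
  dominated convergence applies to the squared differences.\<close>

lemma simple_functions_dense:
  assumes f: "f \<in> sq_integrable M"
  shows "\<exists>s. (\<forall>n. simple_function M (s n) \<and> s n \<in> sq_integrable M) \<and>
    (\<lambda>n. fn_norm M (\<lambda>x. s n x - f x)) \<longlonglongrightarrow> 0"
proof -
  note [measurable] = sq_integrableD(1)[OF f]
  obtain s where s: "\<And>i. simple_function M (s i)"
    and lim: "\<And>x. x \<in> space M \<Longrightarrow> (\<lambda>i. s i x) \<longlonglongrightarrow> f x"
    and bd: "\<And>i x. x \<in> space M \<Longrightarrow> cmod (s i x) \<le> 2 * cmod (f x)"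
    using borel_measurable_implies_sequence_metric[of f M 0]
    by (simp del: norm_conv_dist) (metis norm_conv_dist)
  have sm[measurable]: "s i \<in> borel_measurable M" for i
    using s by (rule borel_measurable_simple_function)
  have "integrable M (\<lambda>x. (cmod (s n x))\<^sup>2)" for n
  proof (rule Bochner_Integration.integrable_bound)
    show "integrable M (\<lambda>x. 4 * (cmod (f x))\<^sup>2)" using sq_integrableD(2)[OF f] by simp
    show "AE x in M. norm ((cmod (s n x))\<^sup>2) \<le> norm (4 * (cmod (f x))\<^sup>2)"
      using bd power_mono[of "cmod (s n _)" "2 * cmod (f _)" 2] by (auto simp: power_mult_distrib)
  qed measurable
  then have "s n \<in> sq_integrable M" for n by (simp add: sq_integrable_def)
  moreover have "(\<lambda>n. fn_norm M (\<lambda>x. s n x - f x)) \<longlonglongrightarrow> 0"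
  proof (rule fn_norm_dominated[OF _ _ _ lim])
    show "integrable M (\<lambda>x. 9 * (cmod (f x))\<^sup>2)" using sq_integrableD(2)[OF f] by simp
    fix n x assume x: "x \<in> space M"
    have "cmod (s n x - f x) \<le> 3 * cmod (f x)"
      using norm_triangle_ineq4[of "s n x" "f x"] bd[OF x, of n] by linarith
    then have "(cmod (s n x - f x))\<^sup>2 \<le> (3 * cmod (f x))\<^sup>2" by (intro power_mono) auto
    then show "(cmod (s n x - f x))\<^sup>2 \<le> 9 * (cmod (f x))\<^sup>2" by (simp add: power_mult_distrib)
  qed measurable
  ultimately show ?thesis using s by blast
qed

text \<open>Riesz-Fischer. Since the measure is finite, an \<open>L\<^sup>2\<close>-Cauchy sequence is \<open>L\<^sup>1\<close>-Cauchy, so a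
  subsequence converges almost everywhere; Fatou's lemma then bounds the \<open>L\<^sup>2\<close> distance of the whole
  sequence from this pointwise limit.\<close>

lemma (in finite_measure) fn_norm_complete:
  assumes f: "\<And>n. f n \<in> sq_integrable M"
    and Cauchy: "\<And>e. e > 0 \<Longrightarrow> \<exists>N. \<forall>i\<ge>N. \<forall>j\<ge>N. fn_norm M (\<lambda>x. f i x - f j x) < e"
  shows "\<exists>g\<in>sq_integrable M. (\<lambda>n. fn_norm M (\<lambda>x. f n x - g x)) \<longlonglongrightarrow> 0"
proof -
  note [measurable] = f[THEN sq_integrableD(1)]
  define c where "c = fn_norm M (\<lambda>x. 1)"
  have one: "(\<lambda>x. 1) \<in> sq_integrable M" by (rule bounded_sq_integrable) auto
  have L1: "(\<integral>x. cmod (h x) \<partial>M) \<le> fn_norm M h * c" if "h \<in> sq_integrable M" for h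
    using integral_cmod_mult_le[OF that one] by (simp add: c_def)
  have int: "integrable M (f n)" for n
    using integrable_fn_inner[OF f[of n] one] by simp
  have c: "0 \<le> c" by (simp add: c_def)
  obtain r where r: "strict_mono r" and Cr: "AE x in M. Cauchy (\<lambda>i. f (r i) x)"
  proof (rule cauchy_L1_AE_cauchy_subseq[of M f, OF int])
    fix e :: real assume "e > 0"
    \<comment> \<open>\<open>c\<close> may vanish, hence the denominator \<open>c + 1\<close>.\<close>
    then have "e / (c + 1) > 0" using c by simp
    from Cauchy[OF this] obtain N where N: "\<And>i j. N \<le> i \<Longrightarrow> N \<le> j \<Longrightarrow> fn_norm M (\<lambda>x. f i x - f j x) < e / (c + 1)"
      by blast
    have "(\<integral>x. cmod (f i x - f j x) \<partial>M) < e" if "N \<le> i" "N \<le> j" for i j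
    proof -
      have "(\<integral>x. cmod (f i x - f j x) \<partial>M) \<le> fn_norm M (\<lambda>x. f i x - f j x) * c"
        by (rule L1[OF sq_integrable_diff[OF f f]])
      also have "\<dots> \<le> fn_norm M (\<lambda>x. f i x - f j x) * (c + 1)" by (intro mult_left_mono) auto
      also have "\<dots> < e" using N[OF that] c by (simp add: pos_less_divide_eq)
      finally show ?thesis .
    qed
    then show "\<exists>N. \<forall>i\<ge>N. \<forall>j\<ge>N. (\<integral>x. cmod (f i x - f j x) \<partial>M) < e" by blast
  qed
  define g where "g x = lim (\<lambda>i. f (r i) x)" for x
  have gm[measurable]: "g \<in> borel_measurable M" unfolding g_def by measurable
  have gl: "AE x in M. (\<lambda>i. f (r i) x) \<longlonglongrightarrow> g x"
    using Cr by (auto elim!: eventually_mono simp: g_def Cauchy_convergent_iff convergent_LIMSEQ_iff)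
  have fatou: "(\<integral>\<^sup>+x. ennreal ((cmod (f n x - g x))\<^sup>2) \<partial>M) \<le> ennreal (e\<^sup>2)"
    if N: "\<And>j. j \<ge> N \<Longrightarrow> fn_norm M (\<lambda>x. f n x - f j x) < e" for e n N
  proof -
    have "(\<integral>\<^sup>+x. ennreal ((cmod (f n x - g x))\<^sup>2) \<partial>M)
        = (\<integral>\<^sup>+x. liminf (\<lambda>i. ennreal ((cmod (f n x - f (r i) x))\<^sup>2)) \<partial>M)"
    proof (rule nn_integral_cong_AE)
      show "AE x in M. ennreal ((cmod (f n x - g x))\<^sup>2) = liminf (\<lambda>i. ennreal ((cmod (f n x - f (r i) x))\<^sup>2))"
        using gl
      proof eventually_elim
        fix x assume "(\<lambda>i. f (r i) x) \<longlonglongrightarrow> g x"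
        then have "(\<lambda>i. ennreal ((cmod (f n x - f (r i) x))\<^sup>2)) \<longlonglongrightarrow> ennreal ((cmod (f n x - g x))\<^sup>2)"
          by (intro tendsto_intros)
        then show "ennreal ((cmod (f n x - g x))\<^sup>2) = liminf (\<lambda>i. ennreal ((cmod (f n x - f (r i) x))\<^sup>2))"
          by (intro lim_imp_Liminf[symmetric]) auto
      qed
    qed
    also have "\<dots> \<le> liminf (\<lambda>i. \<integral>\<^sup>+x. ennreal ((cmod (f n x - f (r i) x))\<^sup>2) \<partial>M)"
      by (rule nn_integral_liminf) measurable
    also have "\<dots> \<le> ennreal (e\<^sup>2)"
    proof (rule Liminf_le)
      show "\<forall>\<^sub>F i in sequentially. (\<integral>\<^sup>+x. ennreal ((cmod (f n x - f (r i) x))\<^sup>2) \<partial>M) \<le> ennreal (e\<^sup>2)"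
        using eventually_ge_at_top[of N]
      proof eventually_elim
        fix i assume "N \<le> i"
        then have "fn_norm M (\<lambda>x. f n x - f (r i) x) < e"
          using N[of "r i"] seq_suble[OF r, of i] by linarith
        then have "(fn_norm M (\<lambda>x. f n x - f (r i) x))\<^sup>2 \<le> e\<^sup>2" by (intro power_mono) auto
        then show "(\<integral>\<^sup>+x. ennreal ((cmod (f n x - f (r i) x))\<^sup>2) \<partial>M) \<le> ennreal (e\<^sup>2)"
          using sq_integrableD(2)[OF sq_integrable_diff[OF f[of n] f[of "r i"]]]
          by (simp add: nn_integral_eq_integral fn_norm_sq ennreal_leI)
      qed
    qed simp
    finally show ?thesis .
  qed
  have diff: "(\<lambda>x. f n x - g x) \<in> sq_integrable M \<and> fn_norm M (\<lambda>x. f n x - g x) \<le> e"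
    if e: "e > 0" and N: "\<And>j. j \<ge> N \<Longrightarrow> fn_norm M (\<lambda>x. f n x - f j x) < e" for e n N
  proof -
    have *: "(\<integral>\<^sup>+x. ennreal ((cmod (f n x - g x))\<^sup>2) \<partial>M) \<le> ennreal (e\<^sup>2)" using fatou N by blast
    have i: "integrable M (\<lambda>x. (cmod (f n x - g x))\<^sup>2)"
      by (rule integrableI_bounded) (use * in \<open>auto simp: less_top[symmetric] top_unique\<close>)
    then have "(fn_norm M (\<lambda>x. f n x - g x))\<^sup>2 \<le> e\<^sup>2"
      using * by (simp add: nn_integral_eq_integral fn_norm_sq ennreal_le_iff)
    then have "fn_norm M (\<lambda>x. f n x - g x) \<le> e" by (rule power2_le_imp_le) (use e in simp)
    with i show ?thesis by (simp add: sq_integrable_def)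
  qed
  obtain N where "\<And>i j. N \<le> i \<Longrightarrow> N \<le> j \<Longrightarrow> fn_norm M (\<lambda>x. f i x - f j x) < 1"
    using Cauchy[of 1] by auto
  then have "(\<lambda>x. f N x - g x) \<in> sq_integrable M" using diff[of 1 N N] by simp
  from sq_integrable_diff[OF f[of N] this] have g: "g \<in> sq_integrable M" by simp
  have "(\<lambda>n. fn_norm M (\<lambda>x. f n x - g x)) \<longlonglongrightarrow> 0"
  proof (rule LIMSEQ_I)
    fix e :: real assume "e > 0"
    then obtain N where N: "\<And>i j. N \<le> i \<Longrightarrow> N \<le> j \<Longrightarrow> fn_norm M (\<lambda>x. f i x - f j x) < e / 2"
      using Cauchy[of "e/2"] by auto
    have "norm (fn_norm M (\<lambda>x. f n x - g x) - 0) < e" if "n \<ge> N" for n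
      using diff[of "e/2" N n] N[OF that] \<open>e > 0\<close> by simp
    then show "\<exists>N. \<forall>n\<ge>N. norm (fn_norm M (\<lambda>x. f n x - g x) - 0) < e" by blast
  qed
  with g show ?thesis by blast
qed

section \<open>The metric space of classes\<close>

lemma equiv_ae_rel: "equiv (sq_integrable M) (ae_rel M)"
proof (rule equivI)
  show "ae_rel M \<subseteq> sq_integrable M \<times> sq_integrable M"
    by (auto simp: ae_rel_def)
  show "refl_on (sq_integrable M) (ae_rel M)" by (auto simp: refl_on_def ae_rel_def)
  show "sym (ae_rel M)" by (auto simp: sym_def ae_rel_def elim: eventually_mono)
  show "trans (ae_rel M)" by (auto simp: trans_def ae_rel_def elim: eventually_elim2)
qed

lemma l2_class_in_l2: "f \<in> sq_integrable M \<Longrightarrow> l2_class M f \<in> l2 M"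
  by (auto simp: l2_def l2_class_def intro: quotientI)

lemma l2_class_cong:
  assumes "f \<in> sq_integrable M" "g \<in> sq_integrable M" "AE x in M. f x = g x"
  shows "l2_class M f = l2_class M g"
  unfolding l2_class_def by (rule equiv_class_eq[OF equiv_ae_rel]) (use assms in \<open>auto simp: ae_rel_def\<close>)

lemma l2_rep_class:
  assumes "f \<in> sq_integrable M"
  shows "l2_rep (l2_class M f) \<in> sq_integrable M" "AE x in M. l2_rep (l2_class M f) x = f x"
proof -
  have "f \<in> l2_class M f" unfolding l2_class_def using equiv_class_self[OF equiv_ae_rel assms] .
  then have "l2_rep (l2_class M f) \<in> l2_class M f" unfolding l2_rep_def by (rule someI[of "\<lambda>g. g \<in> l2_class M f"])
  then show "l2_rep (l2_class M f) \<in> sq_integrable M" "AE x in M. l2_rep (l2_class M f) x = f x"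
    by (auto simp: l2_class_def ae_rel_def elim: eventually_mono)
qed

lemma l2_rep_sq_integrable: "F \<in> l2 M \<Longrightarrow> l2_rep F \<in> sq_integrable M"
  by (auto simp: l2_def l2_class_def[symmetric] elim!: quotientE intro: l2_rep_class)

lemma l2_class_rep:
  assumes "F \<in> l2 M"
  shows "l2_class M (l2_rep F) = F"
proof -
  obtain f where f: "f \<in> sq_integrable M" "F = l2_class M f"
    using assms by (auto simp: l2_def l2_class_def elim: quotientE)
  show ?thesis unfolding f(2) by (rule l2_class_cong) (use f(1) l2_rep_class in auto)
qed

lemma l2_inner_eq: "l2_inner M F G = fn_inner M (l2_rep F) (l2_rep G)"
  by (simp add: l2_inner_def fn_inner_def)

lemma l2_dist_eq: "l2_dist M F G = fn_norm M (\<lambda>x. l2_rep F x - l2_rep G x)"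
  by (simp add: l2_dist_def fn_norm_def)

lemma l2_norm_eq: "l2_norm M F = fn_norm M (l2_rep F)"
  by (simp add: l2_norm_def l2_inner_eq fn_inner_self)

lemma l2_inner_self: "l2_inner M F F = of_real ((l2_norm M F)\<^sup>2)"
  by (simp add: l2_inner_eq fn_inner_self l2_norm_eq)

lemma l2_inner_class_left:
  assumes "f \<in> sq_integrable M" "G \<in> l2 M"
  shows "l2_inner M (l2_class M f) G = fn_inner M f (l2_rep G)"
  unfolding l2_inner_eq
  by (rule fn_inner_cong_AE) (use assms l2_rep_class l2_rep_sq_integrable in auto)

lemma l2_inner_commute: "l2_inner M G F = cnj (l2_inner M F G)"
  unfolding l2_inner_eq by (rule fn_inner_commute)

lemma l2_zero_in_l2: "l2_zero M \<in> l2 M"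
  by (simp add: l2_zero_def l2_class_in_l2 sq_integrable_zero)

lemma l2_add_in_l2: "F \<in> l2 M \<Longrightarrow> G \<in> l2 M \<Longrightarrow> l2_add M F G \<in> l2 M"
  by (simp add: l2_add_def l2_class_in_l2 sq_integrable_add l2_rep_sq_integrable)

lemma l2_scale_in_l2: "F \<in> l2 M \<Longrightarrow> l2_scale M c F \<in> l2 M"
  by (simp add: l2_scale_def l2_class_in_l2 sq_integrable_scale l2_rep_sq_integrable)

lemma l2_sum_in_l2: "(\<And>i. i \<in> I \<Longrightarrow> F i \<in> l2 M) \<Longrightarrow> l2_sum M F I \<in> l2 M"
  by (simp add: l2_sum_def l2_class_in_l2 sq_integrable_sum l2_rep_sq_integrable)

lemma l2_inner_zero_left: "G \<in> l2 M \<Longrightarrow> l2_inner M (l2_zero M) G = 0"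
  by (simp add: l2_zero_def l2_inner_class_left sq_integrable_zero fn_inner_def)

lemma l2_inner_add_left:
  "F \<in> l2 M \<Longrightarrow> G \<in> l2 M \<Longrightarrow> H \<in> l2 M \<Longrightarrow> l2_inner M (l2_add M F G) H = l2_inner M F H + l2_inner M G H"
  by (simp add: l2_add_def l2_inner_class_left sq_integrable_add l2_rep_sq_integrable
      fn_inner_add_left l2_inner_eq[symmetric])

lemma l2_inner_scale_left:
  "F \<in> l2 M \<Longrightarrow> H \<in> l2 M \<Longrightarrow> l2_inner M (l2_scale M c F) H = c * l2_inner M F H"
  by (simp add: l2_scale_def l2_inner_class_left sq_integrable_scale l2_rep_sq_integrable
      fn_inner_scale_left l2_inner_eq[symmetric])

lemma l2_inner_sum_left:
  "(\<And>i. i \<in> I \<Longrightarrow> F i \<in> l2 M) \<Longrightarrow> H \<in> l2 M \<Longrightarrow> l2_inner M (l2_sum M F I) H = (\<Sum>i\<in>I. l2_inner M (F i) H)"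
  by (simp add: l2_sum_def l2_inner_class_left sq_integrable_sum l2_rep_sq_integrable
      fn_inner_sum_left l2_inner_eq[symmetric])

lemma l2_inner_zero_right: "G \<in> l2 M \<Longrightarrow> l2_inner M G (l2_zero M) = 0"
  by (subst l2_inner_commute) (simp add: l2_inner_zero_left)

lemma l2_inner_scale_right:
  "F \<in> l2 M \<Longrightarrow> H \<in> l2 M \<Longrightarrow> l2_inner M H (l2_scale M c F) = cnj c * l2_inner M H F"
  by (subst (1 2) l2_inner_commute) (simp add: l2_inner_scale_left)

lemma l2_inner_sum_right:
  "(\<And>i. i \<in> I \<Longrightarrow> F i \<in> l2 M) \<Longrightarrow> H \<in> l2 M \<Longrightarrow> l2_inner M H (l2_sum M F I) = (\<Sum>i\<in>I. l2_inner M H (F i))"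
  by (subst (1 2) l2_inner_commute) (simp add: l2_inner_sum_left)

lemma fn_norm_diff_sq:
  assumes "f \<in> sq_integrable M" "g \<in> sq_integrable M"
  shows "complex_of_real ((fn_norm M (\<lambda>x. f x - g x))\<^sup>2) =
    fn_inner M f f - fn_inner M f g - fn_inner M g f + fn_inner M g g"
  unfolding fn_inner_self[symmetric]
  by (simp add: fn_inner_diff_left fn_inner_diff_right sq_integrable_diff assms del: fn_inner_self)

lemma l2_dist_sq:
  assumes "F \<in> l2 M" "G \<in> l2 M"
  shows "complex_of_real ((l2_dist M F G)\<^sup>2) =
    l2_inner M F F - l2_inner M F G - l2_inner M G F + l2_inner M G G"
  unfolding l2_dist_eq l2_inner_eq by (rule fn_norm_diff_sq) (use assms l2_rep_sq_integrable in auto)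

lemma Metric_space_l2: "Metric_space (l2 M) (l2_dist M)"
proof
  fix F G H :: "('a \<Rightarrow> complex) set"
  show "0 \<le> l2_dist M F G" by (simp add: l2_dist_eq)
  show "l2_dist M F G = l2_dist M G F" unfolding l2_dist_eq by (rule fn_norm_commute)
  assume F: "F \<in> l2 M" and G: "G \<in> l2 M"
  note FG = F[THEN l2_rep_sq_integrable] G[THEN l2_rep_sq_integrable]
  show "l2_dist M F G = 0 \<longleftrightarrow> F = G"
  proof
    assume "l2_dist M F G = 0"
    then have "AE x in M. l2_rep F x = l2_rep G x"
      using fn_norm_eq_0_iff[OF sq_integrable_diff[OF FG]] by (simp add: l2_dist_eq)
    then have "l2_class M (l2_rep F) = l2_class M (l2_rep G)" by (rule l2_class_cong[OF FG])
    then show "F = G" by (simp add: l2_class_rep F G)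
  next
    assume "F = G" then show "l2_dist M F G = 0" by (simp add: l2_dist_def)
  qed
  assume "H \<in> l2 M"
  then show "l2_dist M F H \<le> l2_dist M F G + l2_dist M G H"
    unfolding l2_dist_eq by (intro fn_norm_triangle_diff FG l2_rep_sq_integrable)
qed

lemmas l2_dist_zero = Metric_space.zero[OF Metric_space_l2]

text \<open>An equality of vectors is thus reduced to computing three inner products. The operator
  identities below are obtained in this way, so that no algebra of representatives is needed.\<close>

lemma l2_eqI:
  assumes "F \<in> l2 M" "G \<in> l2 M" "l2_inner M F F = c" "l2_inner M G G = c" "l2_inner M F G = c"
  shows "F = G"
proof -
  have "cnj c = c" using l2_inner_commute[of M F F] assms(3) by simp
  then have "complex_of_real ((l2_dist M F G)\<^sup>2) = 0"
    unfolding l2_dist_sq[OF assms(1,2)] using assms l2_inner_commute[of M G F] by simp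
  then show ?thesis using l2_dist_zero[OF assms(1,2)] by simp
qed

lemma l2_limitin_iff:
  "limitin (l2_topology M) X F sequentially \<longleftrightarrow>
    F \<in> l2 M \<and> eventually (\<lambda>n. X n \<in> l2 M) sequentially \<and> (\<lambda>n. l2_dist M (X n) F) \<longlonglongrightarrow> 0"
  unfolding l2_topology_def by (rule Metric_space.limitin_metric_dist_null[OF Metric_space_l2])

lemma l2_closedin_iff:
  "closedin (l2_topology M) S \<longleftrightarrow>
    S \<subseteq> l2 M \<and> (\<forall>X F. (\<forall>n. X n \<in> S) \<longrightarrow> F \<in> l2 M \<longrightarrow> (\<lambda>n. l2_dist M (X n) F) \<longlonglongrightarrow> 0 \<longrightarrow> F \<in> S)"
  unfolding l2_topology_def Metric_space.metric_closedin_iff_sequentially_closed[OF Metric_space_l2]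
  unfolding l2_topology_def[symmetric] l2_limitin_iff
  by (auto simp: image_subset_iff) (metis (no_types, lifting) always_eventually subsetD)

lemma l2_limit_unique:
  assumes "\<And>n. X n \<in> l2 M" "F \<in> l2 M" "G \<in> l2 M"
    and "(\<lambda>n. l2_dist M (X n) F) \<longlonglongrightarrow> 0" "(\<lambda>n. l2_dist M (X n) G) \<longlonglongrightarrow> 0"
  shows "F = G"
proof -
  have "limitin (l2_topology M) X F sequentially" "limitin (l2_topology M) X G sequentially"
    using assms by (auto simp: l2_limitin_iff)
  then show ?thesis
    using Metric_space.limitin_metric_unique[OF Metric_space_l2] unfolding l2_topology_def by force
qed

lemma l2_inner_tendsto:
  assumes "\<And>n. X n \<in> l2 M" "\<And>n. Y n \<in> l2 M" "F \<in> l2 M" "G \<in> l2 M"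
    and "(\<lambda>n. l2_dist M (X n) F) \<longlonglongrightarrow> 0" "(\<lambda>n. l2_dist M (Y n) G) \<longlonglongrightarrow> 0"
  shows "(\<lambda>n. l2_inner M (X n) (Y n)) \<longlonglongrightarrow> l2_inner M F G"
  using assms unfolding l2_inner_eq l2_dist_eq by (intro fn_inner_tendsto l2_rep_sq_integrable) auto

lemma l2_inner_tendsto_left:
  assumes "\<And>n. X n \<in> l2 M" "F \<in> l2 M" "G \<in> l2 M" "(\<lambda>n. l2_dist M (X n) F) \<longlonglongrightarrow> 0"
  shows "(\<lambda>n. l2_inner M (X n) G) \<longlonglongrightarrow> l2_inner M F G"
  using assms by (intro l2_inner_tendsto) (auto simp: l2_dist_def)

lemma l2_dist_class_right:
  assumes "F \<in> l2 M" "g \<in> sq_integrable M"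
  shows "l2_dist M F (l2_class M g) = fn_norm M (\<lambda>x. l2_rep F x - g x)"
  unfolding l2_dist_eq
  by (rule fn_norm_cong_AE)
    (use assms in \<open>auto intro!: sq_integrable_diff l2_rep_sq_integrable l2_class_in_l2 
       eventually_mono[OF l2_rep_class(2)[OF assms(2)]]\<close>)

lemma (in finite_measure) l2_complete:
  assumes X: "\<And>n. X n \<in> l2 M"
    and Cauchy: "\<And>e. e > 0 \<Longrightarrow> \<exists>N. \<forall>i\<ge>N. \<forall>j\<ge>N. l2_dist M (X i) (X j) < e"
  shows "\<exists>F\<in>l2 M. (\<lambda>n. l2_dist M (X n) F) \<longlonglongrightarrow> 0"
proof -
  obtain g where g: "g \<in> sq_integrable M" and l: "(\<lambda>n. fn_norm M (\<lambda>x. l2_rep (X n) x - g x)) \<longlonglongrightarrow> 0"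
    using fn_norm_complete[of "\<lambda>n. l2_rep (X n)"] X Cauchy by (auto simp: l2_dist_eq l2_rep_sq_integrable)
  then have "(\<lambda>n. l2_dist M (X n) (l2_class M g)) \<longlonglongrightarrow> 0" by (simp add: l2_dist_class_right X)
  then show ?thesis using l2_class_in_l2[OF g] by blast
qed

section \<open>Maps that preserve inner products\<close>

text \<open>The domain consists of functions and not of classes, so that a map can be given by a formula
  on simple functions. Equality almost everywhere is respected because distances are preserved.\<close>

definition inner_preserving ::
  "('b \<Rightarrow> complex) set \<Rightarrow> 'b measure \<Rightarrow> 'a measure \<Rightarrow> (('b \<Rightarrow> complex) \<Rightarrow> ('a \<Rightarrow> complex) set) \<Rightarrow> bool" where
  "inner_preserving D N M W \<longleftrightarrow> D \<subseteq> sq_integrable N \<and> (\<forall>f\<in>D. W f \<in> l2 M) \<and>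
     (\<forall>f\<in>D. \<forall>g\<in>D. l2_inner M (W f) (W g) = fn_inner N f g)"

lemma inner_preserving_dist:
  assumes W: "inner_preserving D N M W" and "f \<in> D" "g \<in> D"
  shows "l2_dist M (W f) (W g) = fn_norm N (\<lambda>x. f x - g x)"
proof -
  have "W f \<in> l2 M" "W g \<in> l2 M" "f \<in> sq_integrable N" "g \<in> sq_integrable N"
    using assms by (auto simp: inner_preserving_def)
  then have "complex_of_real ((l2_dist M (W f) (W g))\<^sup>2) = of_real ((fn_norm N (\<lambda>x. f x - g x))\<^sup>2)"
    using assms by (simp only: l2_dist_sq fn_norm_diff_sq) (simp add: inner_preserving_def)
  then have "(l2_dist M (W f) (W g))\<^sup>2 = (fn_norm N (\<lambda>x. f x - g x))\<^sup>2" by (simp only: of_real_eq_iff)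
  then show ?thesis by (simp add: l2_dist_eq)
qed

text \<open>Preserving inner products forces linearity: the squared norm of \<open>W (f + g) - (W f + W g)\<close>
  expands into inner products, and these cancel as they do for \<open>f + g\<close> itself.\<close>

lemma inner_preserving_add:
  assumes W: "inner_preserving (sq_integrable N) N M W"
    and f: "f \<in> sq_integrable N" and g: "g \<in> sq_integrable N"
  shows "W (\<lambda>x. f x + g x) = l2_add M (W f) (W g)"
proof -
  let ?h = "\<lambda>x. f x + g x" and ?G = "l2_add M (W f) (W g)"
  have h: "?h \<in> sq_integrable N" using f g by (rule sq_integrable_add)
  have in_l2: "W k \<in> l2 M" if "k \<in> sq_integrable N" for k using W that by (auto simp: inner_preserving_def)
  have ip: "l2_inner M (W k) (W l) = fn_inner N k l" if "k \<in> sq_integrable N" "l \<in> sq_integrable N" for k l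
    using W that by (auto simp: inner_preserving_def)
  have G: "?G \<in> l2 M" by (simp add: l2_add_in_l2 in_l2 f g)
  have GW: "l2_inner M ?G (W k) = fn_inner N ?h k" if "k \<in> sq_integrable N" for k
    using that by (simp add: l2_inner_add_left fn_inner_add_left in_l2 f g ip)
  have WG: "l2_inner M (W k) ?G = fn_inner N k ?h" if "k \<in> sq_integrable N" for k
    by (subst l2_inner_commute, subst fn_inner_commute) (simp only: GW[OF that])
  have GG: "l2_inner M ?G ?G = fn_inner N ?h ?h"
    by (simp add: l2_inner_add_left in_l2 f g G WG fn_inner_add_left h)
  show ?thesis by (rule l2_eqI[OF in_l2[OF h] G]) (simp_all add: GG WG ip h)
qed

lemma inner_preserving_scale:
  assumes W: "inner_preserving (sq_integrable N) N M W" and f: "f \<in> sq_integrable N"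
  shows "W (\<lambda>x. c * f x) = l2_scale M c (W f)"
proof -
  let ?h = "\<lambda>x. c * f x" and ?G = "l2_scale M c (W f)"
  have h: "?h \<in> sq_integrable N" using f by (rule sq_integrable_scale)
  have in_l2: "W k \<in> l2 M" if "k \<in> sq_integrable N" for k using W that by (auto simp: inner_preserving_def)
  have ip: "l2_inner M (W k) (W l) = fn_inner N k l" if "k \<in> sq_integrable N" "l \<in> sq_integrable N" for k l
    using W that by (auto simp: inner_preserving_def)
  have G: "?G \<in> l2 M" by (simp add: l2_scale_in_l2 in_l2 f)
  have GW: "l2_inner M ?G (W k) = fn_inner N ?h k" if "k \<in> sq_integrable N" for k
    using that by (simp add: l2_inner_scale_left fn_inner_scale_left in_l2 f ip)
  have WG: "l2_inner M (W k) ?G = fn_inner N k ?h" if "k \<in> sq_integrable N" for k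
    by (subst l2_inner_commute, subst fn_inner_commute) (simp only: GW[OF that])
  have GG: "l2_inner M ?G ?G = fn_inner N ?h ?h"
    by (simp add: l2_inner_scale_left in_l2 f G WG fn_inner_scale_left h)
  show ?thesis by (rule l2_eqI[OF in_l2[OF h] G]) (simp_all add: GG WG ip h)
qed

lemma fn_Cauchy:
  assumes f: "f \<in> sq_integrable N" and s: "\<And>n. s n \<in> sq_integrable N"
    and lim: "(\<lambda>n. fn_norm N (\<lambda>x. s n x - f x)) \<longlonglongrightarrow> 0" and e: "e > 0"
  shows "\<exists>n0. \<forall>i\<ge>n0. \<forall>j\<ge>n0. fn_norm N (\<lambda>x. s i x - s j x) < e"
proof -
  have "\<forall>\<^sub>F n in sequentially. fn_norm N (\<lambda>x. s n x - f x) < e / 2"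
    using order_tendstoD(2)[OF lim, of "e/2"] e by simp
  then obtain n0 where n0: "\<And>n. n \<ge> n0 \<Longrightarrow> fn_norm N (\<lambda>x. s n x - f x) < e / 2"
    by (auto simp: eventually_sequentially)
  have "fn_norm N (\<lambda>x. s i x - s j x) < e" if "i \<ge> n0" "j \<ge> n0" for i j
    using fn_norm_triangle_diff[OF s f s, of i j] fn_norm_commute[of N f "s j"] n0[OF that(1)] n0[OF that(2)]
    by linarith
  then show ?thesis by blast
qed

text \<open>A map on a dense set extends by continuity, since it sends an approximating sequence to a
  Cauchy sequence, and inner products survive the passage to the limit.\<close>

lemma (in finite_measure) extend_isometry:
  assumes W0: "inner_preserving D N M W0"
    and dense: "\<And>f. f \<in> sq_integrable N \<Longrightarrow> \<exists>s. (\<forall>n. s n \<in> D) \<and> (\<lambda>n. fn_norm N (\<lambda>x. s n x - f x)) \<longlonglongrightarrow> 0"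
  shows "\<exists>W. inner_preserving (sq_integrable N) N M W \<and> (\<forall>f\<in>D. W f = W0 f)"
proof -
  have D: "s \<in> sq_integrable N" "W0 s \<in> l2 M" if "s \<in> D" for s
    using W0 that by (auto simp: inner_preserving_def)
  have ip0: "l2_inner M (W0 s) (W0 t) = fn_inner N s t" if "s \<in> D" "t \<in> D" for s t
    using W0 that by (auto simp: inner_preserving_def)
  define approx where "approx f F s \<longleftrightarrow> F \<in> l2 M \<and> (\<forall>n. s n \<in> D) \<and>
      (\<lambda>n. fn_norm N (\<lambda>x. s n x - f x)) \<longlonglongrightarrow> 0 \<and> (\<lambda>n. l2_dist M (W0 (s n)) F) \<longlonglongrightarrow> 0"
    for f F and s :: "nat \<Rightarrow> 'b \<Rightarrow> complex"
  have "\<exists>F s. approx f F s" if f: "f \<in> sq_integrable N" for f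
  proof -
    obtain s where s: "\<And>n. s n \<in> D" "(\<lambda>n. fn_norm N (\<lambda>x. s n x - f x)) \<longlonglongrightarrow> 0"
      using dense[OF f] by blast
    have "\<exists>F\<in>l2 M. (\<lambda>n. l2_dist M (W0 (s n)) F) \<longlonglongrightarrow> 0"
      by (rule l2_complete)
        (use s D fn_Cauchy[OF f D(1)[OF s(1)] s(2)] in \<open>auto simp: inner_preserving_dist[OF W0]\<close>)
    with s show ?thesis unfolding approx_def by blast
  qed
  then obtain W S where "\<And>f. f \<in> sq_integrable N \<Longrightarrow> approx f (W f) (S f)"
    by metis
  then have WS: "f \<in> sq_integrable N \<Longrightarrow> W f \<in> l2 M \<and> (\<forall>n. S f n \<in> D) \<and>
      (\<lambda>n. fn_norm N (\<lambda>x. S f n x - f x)) \<longlonglongrightarrow> 0 \<and> (\<lambda>n. l2_dist M (W0 (S f n)) (W f)) \<longlonglongrightarrow> 0" for f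
    unfolding approx_def by blast
  have ip: "l2_inner M (W f) G = c" if f: "f \<in> sq_integrable N" and G: "G \<in> l2 M"
    and Gn: "\<And>n. Gn n \<in> l2 M" "(\<lambda>n. l2_dist M (Gn n) G) \<longlonglongrightarrow> 0"
    and c: "(\<lambda>n. l2_inner M (W0 (S f n)) (Gn n)) \<longlonglongrightarrow> c" for f G Gn c
  proof (rule LIMSEQ_unique[OF _ c])
    show "(\<lambda>n. l2_inner M (W0 (S f n)) (Gn n)) \<longlonglongrightarrow> l2_inner M (W f) G"
      by (rule l2_inner_tendsto) (use WS[OF f] D G Gn in auto)
  qed
  have W: "inner_preserving (sq_integrable N) N M W"
    unfolding inner_preserving_def
  proof (intro conjI ballI subset_refl)
    fix f g assume f: "f \<in> sq_integrable N" and g: "g \<in> sq_integrable N"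
    show "l2_inner M (W f) (W g) = fn_inner N f g"
    proof (rule ip[OF f, where Gn="\<lambda>n. W0 (S g n)"])
      have "(\<lambda>n. fn_inner N (S f n) (S g n)) \<longlonglongrightarrow> fn_inner N f g"
        by (rule fn_inner_tendsto) (use WS[OF f] WS[OF g] D f g in auto)
      then show "(\<lambda>n. l2_inner M (W0 (S f n)) (W0 (S g n))) \<longlonglongrightarrow> fn_inner N f g"
        using WS[OF f] WS[OF g] by (simp add: ip0)
    qed (use WS[OF g] D in auto)
  qed (use WS in auto)
  have "W f = W0 f" if f: "f \<in> D" for f
  proof (rule l2_limit_unique)
    show "(\<lambda>n. l2_dist M (W0 (S f n)) (W f)) \<longlonglongrightarrow> 0" using WS D f by blast
    show "(\<lambda>n. l2_dist M (W0 (S f n)) (W0 f)) \<longlonglongrightarrow> 0"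
      using WS[OF D(1)[OF f]] f by (simp add: inner_preserving_dist[OF W0])
  qed (use WS[OF D(1)[OF f]] D f in auto)
  with W show ?thesis by blast
qed

lemma inner_preserving_eqI:
  assumes W: "inner_preserving D N M W" and "f \<in> D" "g \<in> D" "fn_norm N (\<lambda>x. f x - g x) = 0"
  shows "W f = W g"
proof -
  have "W f \<in> l2 M" "W g \<in> l2 M" using assms by (auto simp: inner_preserving_def)
  then show ?thesis
    using l2_dist_zero[of "W f" M "W g"] inner_preserving_dist[OF W assms(2,3)] assms(4) by simp
qed

text \<open>The range is closed because the domain is complete: a convergent sequence of images is
  Cauchy, hence so are its preimages.\<close>

lemma inner_preserving_range_closed:
  assumes "finite_measure N" and W: "inner_preserving (sq_integrable N) N M W"
  shows "closed_l2_subspace M (W ` sq_integrable N)"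
  unfolding closed_l2_subspace_def l2_closedin_iff
proof (intro conjI allI ballI impI)
  let ?D = "sq_integrable N"
  interpret N: finite_measure N by fact
  have W_in: "W f \<in> l2 M" if "f \<in> ?D" for f using W that by (auto simp: inner_preserving_def)
  have W_inner: "l2_inner M (W f) (W g) = fn_inner N f g" if "f \<in> ?D" "g \<in> ?D" for f g
    using W that by (auto simp: inner_preserving_def)
  have "W (\<lambda>z. 0) = l2_zero M"
    by (rule l2_eqI[where M=M and c=0])
      (simp_all add: W_in W_inner sq_integrable_zero l2_zero_in_l2 l2_inner_zero_left
        l2_inner_zero_right fn_inner_def)
  then show "l2_zero M \<in> W ` ?D" using sq_integrable_zero by (metis imageI)
  show "W ` ?D \<subseteq> l2 M" "W ` ?D \<subseteq> l2 M" using W_in by auto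
  show "l2_add M F G \<in> W ` ?D" if "F \<in> W ` ?D" "G \<in> W ` ?D" for F G
    using that inner_preserving_add[OF W] sq_integrable_add by (auto intro!: image_eqI)
  show "l2_scale M c F \<in> W ` ?D" if "F \<in> W ` ?D" for c F
    using that inner_preserving_scale[OF W] sq_integrable_scale by (auto intro!: image_eqI)
  fix X F assume X: "\<forall>n. X n \<in> W ` ?D" and F: "F \<in> l2 M" and l: "(\<lambda>n. l2_dist M (X n) F) \<longlonglongrightarrow> 0"
  then have "\<forall>n. \<exists>f. f \<in> ?D \<and> X n = W f" by blast
  from choice[OF this] obtain f where f: "\<And>n. f n \<in> ?D" and Xf: "\<And>n. X n = W (f n)" by blast
  have Xl: "X n \<in> l2 M" for n by (simp add: Xf W_in f)
  have "\<exists>g\<in>?D. (\<lambda>n. fn_norm N (\<lambda>z. f n z - g z)) \<longlonglongrightarrow> 0"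
  proof (rule N.fn_norm_complete[OF f])
    fix e :: real assume e: "e > 0"
    show "\<exists>n0. \<forall>i\<ge>n0. \<forall>j\<ge>n0. fn_norm N (\<lambda>z. f i z - f j z) < e"
      using fn_Cauchy[OF l2_rep_sq_integrable[OF F] l2_rep_sq_integrable[OF Xl] _ e] l
      by (simp add: l2_dist_eq[symmetric] Xf inner_preserving_dist[OF W] f)
  qed
  then obtain g where g: "g \<in> ?D" "(\<lambda>n. fn_norm N (\<lambda>z. f n z - g z)) \<longlonglongrightarrow> 0" by blast
  have "F = W g"
    by (rule l2_limit_unique[OF Xl F W_in[OF g(1)] l])
      (use g f in \<open>simp add: Xf inner_preserving_dist[OF W]\<close>)
  then show "F \<in> W ` ?D" using g(1) by blast
qed

text \<open>On classes, \<open>W\<close> becomes an isometric bijection \<open>V\<close> of \<open>l2 N\<close> onto its range; the isomorphism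
  asked for in \<^const>\<open>l2_isometric_iso\<close> points the other way and is the inverse of \<open>V\<close>.\<close>

lemma inner_preserving_induces_iso:
  assumes W: "inner_preserving (sq_integrable N) N M W"
  shows "\<exists>T. l2_isometric_iso M (W ` sq_integrable N) N T"
proof -
  let ?D = "sq_integrable N"
  have W_in: "W f \<in> l2 M" if "f \<in> ?D" for f using W that by (auto simp: inner_preserving_def)
  have W_inner: "l2_inner M (W f) (W g) = fn_inner N f g" if "f \<in> ?D" "g \<in> ?D" for f g
    using W that by (auto simp: inner_preserving_def)
  define V where "V G = W (l2_rep G)" for G
  have rep: "l2_rep G \<in> ?D" if "G \<in> l2 N" for G using that by (rule l2_rep_sq_integrable)
  have V_class: "V (l2_class N f) = W f" if f: "f \<in> ?D" for f
    unfolding V_def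
  proof (rule inner_preserving_eqI[OF W rep[OF l2_class_in_l2[OF f]] f])
    have "l2_dist N (l2_class N f) (l2_class N f) = 0" by (simp add: l2_dist_def)
    then show "fn_norm N (\<lambda>z. l2_rep (l2_class N f) z - f z) = 0"
      by (simp add: l2_dist_class_right f l2_class_in_l2)
  qed
  have V_dist: "l2_dist M (V F) (V G) = l2_dist N F G" if "F \<in> l2 N" "G \<in> l2 N" for F G
    using that by (simp add: V_def inner_preserving_dist[OF W] rep l2_dist_eq[of N])
  have V_in: "V G \<in> l2 M" if "G \<in> l2 N" for G using that by (simp add: V_def W_in rep)
  have bij: "bij_betw V (l2 N) (W ` ?D)"
  proof (rule bij_betw_imageI)
    show "inj_on V (l2 N)"
    proof (rule inj_onI)
      fix F G assume FG: "F \<in> l2 N" "G \<in> l2 N" "V F = V G"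
      then have "l2_dist N F G = 0" using V_dist[of F G] by (simp add: l2_dist_def)
      then show "F = G" using l2_dist_zero[OF FG(1,2)] by simp
    qed
    show "V ` l2 N = W ` ?D"
    proof (intro equalityI image_subsetI)
      show "V G \<in> W ` ?D" if "G \<in> l2 N" for G unfolding V_def using rep[OF that] by (rule imageI)
      show "W f \<in> V ` l2 N" if "f \<in> ?D" for f
        using imageI[OF l2_class_in_l2[OF that], of V] by (simp only: V_class[OF that])
    qed
  qed
  have V_add: "V (l2_add N F G) = l2_add M (V F) (V G)" if "F \<in> l2 N" "G \<in> l2 N" for F G
    unfolding l2_add_def[of N] V_class[OF sq_integrable_add[OF rep[OF that(1)] rep[OF that(2)]]]
    using that by (simp add: V_def rep inner_preserving_add[OF W])
  have V_scale: "V (l2_scale N c F) = l2_scale M c (V F)" if "F \<in> l2 N" for c F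
    unfolding l2_scale_def[of N] V_class[OF sq_integrable_scale[OF rep[OF that]]]
    using that by (simp add: V_def rep inner_preserving_scale[OF W])
  have V_norm: "l2_norm M (V F) = l2_norm N F" if "F \<in> l2 N" for F
    using that by (simp add: V_def l2_norm_def W_inner rep l2_inner_eq[of N])
  define T where "T = inv_into (l2 N) V"
  have T_bij: "bij_betw T (W ` ?D) (l2 N)" unfolding T_def by (rule bij_betw_inv_into[OF bij])
  have TV: "T (V G) = G" if "G \<in> l2 N" for G
    unfolding T_def by (rule bij_betw_inv_into_left[OF bij that])
  have img: "\<exists>G\<in>l2 N. F = V G" if "F \<in> W ` ?D" for F
    using that unfolding bij_betw_imp_surj_on[OF bij, symmetric] by blast
  have "l2_isometric_iso M (W ` ?D) N T"
    unfolding l2_isometric_iso_def l2_linear_on_def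
  proof (intro conjI ballI allI T_bij)
    fix F assume "F \<in> W ` ?D"
    then obtain F' where F: "F' \<in> l2 N" "F = V F'" using img by blast
    show "T F \<in> l2 N" by (simp add: F TV)
    show "l2_norm N (T F) = l2_norm M F" by (simp add: F TV V_norm)
    show "T (l2_scale M c F) = l2_scale N c (T F)" for c
      by (simp add: F TV V_scale[symmetric] l2_scale_in_l2)
    fix G assume "G \<in> W ` ?D"
    then obtain G' where G: "G' \<in> l2 N" "G = V G'" using img by blast
    show "T (l2_add M F G) = l2_add N (T F) (T G)"
      by (simp add: F G TV V_add[symmetric] l2_add_in_l2)
  qed
  then show ?thesis by blast
qed


section \<open>Density of the trigonometric polynomials\<close>

lemma sets_circle_borel_imp_borel: "A \<in> sets circle_borel \<Longrightarrow> A \<in> sets borel"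
  unfolding circle_borel_def by (subst (asm) sets_restrict_space_iff) auto

lemma space_circle_borel [simp]: "space circle_borel = sphere 0 1"
  by (simp add: circle_borel_def space_restrict_space)

text \<open>Splitting according to the value of \<open>s\<close>. The summand \<open>h\<close> is arbitrary, so the
  rule can be nested to treat several functions at once.\<close>

lemma sum_level_sets:
  fixes h :: "'b \<Rightarrow> 'c::real_vector"
  assumes "finite (s ` A)" "x \<in> A"
  shows "(\<Sum>c\<in>s ` A. indicator (s -` {c} \<inter> A) x *\<^sub>R h c) = h (s x)"
proof -
  have "(\<Sum>c\<in>s ` A. indicator (s -` {c} \<inter> A) x *\<^sub>R h c) = (\<Sum>c\<in>s ` A. if s x = c then h c else 0)"
    by (rule sum.cong) (use assms(2) in \<open>auto simp: indicator_def\<close>)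
  also have "\<dots> = h (s x)" using assms by simp
  finally show ?thesis .
qed

text \<open>Stone-Weierstrass in the form that bounded convergence can use: a uniformly bounded sequence
  of polynomials, converging pointwise.\<close>

lemma continuous_real_polynomial_limit:
  fixes g :: "'a::euclidean_space \<Rightarrow> real"
  assumes "compact S" "continuous_on S g"
  shows "\<exists>p B. (\<forall>n::nat. real_polynomial_function (p n)) \<and> (\<forall>n. \<forall>z\<in>S. \<bar>p n z\<bar> \<le> B) \<and>
    (\<forall>z\<in>S. (\<lambda>n. p n z) \<longlonglongrightarrow> g z)"
proof -
  obtain B where B: "\<forall>y\<in>g ` S. \<bar>y\<bar> \<le> B"
    using compact_imp_bounded[OF compact_continuous_image[OF assms(2,1)]]
    unfolding bounded_iff real_norm_def by blast
  define e where "e n = inverse (real (Suc n))" for n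
  have e: "0 < e n" "e n \<le> 1" for n
    using le_imp_inverse_le[of 1 "real (Suc n)"] by (auto simp: e_def)
  have e_lim: "e \<longlonglongrightarrow> 0" unfolding e_def[abs_def] by (rule LIMSEQ_inverse_real_of_nat)
  have "\<forall>n. \<exists>p. real_polynomial_function p \<and> (\<forall>z\<in>S. \<bar>g z - p z\<bar> < e n)"
    by (rule allI, rule Stone_Weierstrass_real_polynomial_function[OF assms e(1)],
        rule exI, rule conjI, assumption, rule ballI, assumption)
  from choice[OF this] obtain p where
    "\<forall>n. real_polynomial_function (p n) \<and> (\<forall>z\<in>S. \<bar>g z - p n z\<bar> < e n)" ..
  then have p: "real_polynomial_function (p n)"
    and pg: "z \<in> S \<Longrightarrow> \<bar>g z - p n z\<bar> < e n" for n z by (simp_all only:)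
  show ?thesis
  proof (intro exI conjI allI ballI)
    show "real_polynomial_function (p n)" for n by (rule p)
    fix z assume z: "z \<in> S"
    have "\<bar>g z\<bar> \<le> B" using B z by blast
    then show "\<bar>p n z\<bar> \<le> B + 1" for n
      using pg[OF z, of n] e(2)[of n] by linarith
    have "norm (p n z - g z) \<le> e n" for n
      using pg[OF z, of n] unfolding real_norm_def by linarith
    then have "\<forall>n. norm (p n z - g z) \<le> e n" ..
    from Lim_null_comparison[OF always_eventually[OF this] e_lim]
    show "(\<lambda>n. p n z) \<longlonglongrightarrow> g z"
      by (rule LIM_zero_cancel[of "\<lambda>n. p n z" "g z"])
  qed
qed
text \<open>The trigonometric polynomials are dense in \<open>L\<^sup>2\<close> of any finite Borel measure on the circle.
  Instead of \<open>z\<^sup>n\<close>, the statement uses stability of the closed subspace \<open>C\<close> under multiplication by \<open>z\<close>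
  and \<open>cnj z\<close>. The class \<open>C\<close> is enlarged in steps: real polynomials in the two coordinates (which are
  linear combinations of \<open>z\<close> and \<open>cnj z\<close>), continuous functions by Stone-Weierstrass, indicators of
  closed sets as limits of continuous functions, indicators of Borel sets by Dynkin's theorem,
  simple functions, and finally everything.\<close>

lemma sq_integrable_circle_dense:
  assumes "finite_measure N" and sN: "sets N = sets circle_borel"
    and C: "C \<subseteq> sq_integrable N"
    and add: "\<And>f g. f \<in> C \<Longrightarrow> g \<in> C \<Longrightarrow> (\<lambda>z. f z + g z) \<in> C"
    and scale: "\<And>c f. f \<in> C \<Longrightarrow> (\<lambda>z. c * f z) \<in> C"
    and lim: "\<And>f s. f \<in> sq_integrable N \<Longrightarrow> (\<And>n. s n \<in> C) \<Longrightarrow>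
        (\<lambda>n. fn_norm N (\<lambda>z. s n z - f z)) \<longlonglongrightarrow> 0 \<Longrightarrow> f \<in> C"
    and one: "(\<lambda>z. 1) \<in> C"
    and mult: "\<And>f. f \<in> C \<Longrightarrow> (\<lambda>z. z * f z) \<in> C"
    and mult_cnj: "\<And>f. f \<in> C \<Longrightarrow> (\<lambda>z. cnj z * f z) \<in> C"
  shows "C = sq_integrable N"
proof -
  interpret finite_measure N by fact
  have sp: "space N = sphere 0 1" using sets_eq_imp_space_eq[OF sN] by simp
  have meas: "f \<in> borel_measurable N" if "f \<in> borel_measurable circle_borel" for f :: "complex \<Rightarrow> complex"
    using that measurable_cong_sets[OF sN refl] by blast
  have meas_borel: "f \<in> borel_measurable N" if "f \<in> borel_measurable borel" for f :: "complex \<Rightarrow> complex"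
    by (rule meas) (use that in \<open>simp add: circle_borel_def measurable_restrict_space1\<close>)
  have bounded_lim: "f \<in> C" if s: "\<And>n. s n \<in> C" and f: "f \<in> borel_measurable N"
    and B: "\<And>n z. z \<in> sphere 0 1 \<Longrightarrow> cmod (s n z) \<le> B"
    and l: "\<And>z. z \<in> sphere 0 1 \<Longrightarrow> (\<lambda>n. s n z) \<longlonglongrightarrow> f z" for s f B
  proof (rule lim[OF _ s])
    have fB: "cmod (f z) \<le> B" if "z \<in> sphere 0 1" for z
      by (rule LIMSEQ_le_const2[OF tendsto_norm[OF l[OF that]]]) (use B that in blast)
    show "f \<in> sq_integrable N" by (rule bounded_sq_integrable[OF f]) (use fB sp in auto)
    show "(\<lambda>n. fn_norm N (\<lambda>z. s n z - f z)) \<longlonglongrightarrow> 0"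
    proof (rule fn_norm_dominated[OF f])
      show "s n \<in> borel_measurable N" for n using s C sq_integrableD by blast
      show "integrable N (\<lambda>z. (2 * B)\<^sup>2)" by simp
      show "(\<lambda>n. s n z) \<longlonglongrightarrow> f z" if "z \<in> space N" for z using l that sp by simp
      fix n z assume "z \<in> space N"
      then have "cmod (s n z - f z) \<le> 2 * B"
        using norm_triangle_ineq4[of "s n z" "f z"] B[of z n] fB[of z] sp by simp
      then show "(cmod (s n z - f z))\<^sup>2 \<le> (2 * B)\<^sup>2" by (intro power_mono) auto
    qed
  qed
  \<comment> \<open>Membership in \<open>C\<close> does not see values off the circle: a constant sequence converges.\<close>
  have cong: "g \<in> C" if f: "f \<in> C" and fg: "\<And>z. z \<in> sphere 0 1 \<Longrightarrow> g z = f z" for f g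
  proof (rule lim)
    have "f \<in> sq_integrable N" using f C by blast
    then show "g \<in> sq_integrable N"
      unfolding sq_integrable_def
      using measurable_cong[of N g f borel] fg sp
        Bochner_Integration.integrable_cong[of N N "\<lambda>x. (cmod (g x))\<^sup>2" "\<lambda>x. (cmod (f x))\<^sup>2"]
      by auto
    have "fn_norm N (\<lambda>z. f z - g z) = 0"
      using Bochner_Integration.integral_cong[of N N "\<lambda>x. (cmod (f x - g x))\<^sup>2" "\<lambda>x. 0"] fg sp
      by (simp add: fn_norm_def)
    then show "(\<lambda>n::nat. fn_norm N (\<lambda>z. f z - g z)) \<longlonglongrightarrow> 0" by simp
  qed (rule f)
  have poly: "(\<lambda>z. of_real (p z) * f z) \<in> C" if "real_polynomial_function p" "f \<in> C" for p f
    using that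
  proof (induction arbitrary: f)
    case (linear h)
    \<comment> \<open>A real linear form is \<open>2 * Re (a * z)\<close> for one complex number \<open>a\<close>.\<close>
    define a where "a = (of_real (h 1) - \<i> * of_real (h \<i>)) / 2"
    have hz: "complex_of_real (h z) = a * z + cnj a * cnj z" for z
    proof -
      interpret h: bounded_linear h by fact
      have "h z = h (Re z *\<^sub>R 1 + Im z *\<^sub>R \<i>)" by (rule arg_cong[where f=h]) (simp add: complex_eq_iff)
      also have "\<dots> = Re z * h 1 + Im z * h \<i>" by (simp only: h.add h.scaleR real_scaleR_def)
      finally show ?thesis by (simp add: a_def complex_eq_iff field_simps)
    qed
    have "(\<lambda>z. a * (z * f z) + cnj a * (cnj z * f z)) \<in> C"
      by (intro add scale mult mult_cnj linear)
    then show ?case by (simp add: hz algebra_simps)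
  next
    case (const c) then show ?case by (rule scale)
  next
    case (add p q) then show ?case using assms(4)[of "\<lambda>z. of_real (p z) * f z" "\<lambda>z. of_real (q z) * f z"]
      by (simp add: algebra_simps)
  next
    case (mult p q) then show ?case by (simp add: mult.assoc)
  qed
  have cont: "(\<lambda>z. complex_of_real (g z)) \<in> C" if g: "continuous_on (sphere 0 1) g" for g
  proof -
    obtain p B where pB: "(\<forall>n::nat. real_polynomial_function (p n)) \<and>
        (\<forall>n. \<forall>z\<in>sphere 0 1. \<bar>p n z\<bar> \<le> B) \<and> (\<forall>z\<in>sphere 0 1. (\<lambda>n. p n z) \<longlonglongrightarrow> g z)"
      using continuous_real_polynomial_limit[OF compact_sphere g] by (elim exE)
    then have p: "real_polynomial_function (p n)" for n by (simp only:)
    show ?thesis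
    proof (rule bounded_lim[where s="\<lambda>n z. of_real (p n z)" and B=B])
      show "(\<lambda>z. complex_of_real (p n z)) \<in> C" for n using poly[OF p one, of n] by simp
      show "(\<lambda>z. complex_of_real (g z)) \<in> borel_measurable N"
        by (rule meas)
          (auto simp: circle_borel_def intro!: borel_measurable_continuous_on_restrict continuous_intros g)
    qed (use pB in \<open>simp_all add: tendsto_of_real\<close>)
  qed
  have closed: "(indicator A :: complex \<Rightarrow> complex) \<in> C" if A: "closed A" for A
  proof (cases "A = {}")
    case True
    have "(indicator {} :: complex \<Rightarrow> complex) = (\<lambda>z. 0 * 1)" by (simp add: fun_eq_iff)
    with True show ?thesis using scale[OF one, of 0] by (simp only:)
  next
    case False
    show ?thesis
    proof (rule bounded_lim[where s="\<lambda>n z. of_real (max 0 (1 - real n * infdist z A))" and B=1])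
      show "(\<lambda>z. complex_of_real (max 0 (1 - real n * infdist z A))) \<in> C" for n
        by (rule cont) (intro continuous_intros)
      show "(indicator A :: complex \<Rightarrow> complex) \<in> borel_measurable N"
        by (rule meas_borel) (use A in simp)
      fix z :: complex
      show "cmod (of_real (max 0 (1 - real n * infdist z A))) \<le> 1" for n
        by (simp add: infdist_nonneg)
      show "(\<lambda>n. complex_of_real (max 0 (1 - real n * infdist z A))) \<longlonglongrightarrow> indicator A z"
      proof (cases "z \<in> A")
        case True then show ?thesis by simp
      next
        case zA: False
        then have "infdist z A > 0"
          using in_closed_iff_infdist_zero[OF A False, of z] infdist_nonneg[of z A] by linarith
        then obtain m where m: "1 < real m * infdist z A" using reals_Archimedean3 by blast
        have "\<forall>\<^sub>F n in sequentially. complex_of_real (max 0 (1 - real n * infdist z A)) = indicator A z"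
          using eventually_ge_at_top[of m]
        proof eventually_elim
          fix n assume "m \<le> n"
          then have "real m * infdist z A \<le> real n * infdist z A"
            by (intro mult_right_mono) (auto simp: infdist_nonneg)
          then show "complex_of_real (max 0 (1 - real n * infdist z A)) = indicator A z"
            using m zA by simp
        qed
        then show ?thesis by (rule tendsto_eventually)
      qed
    qed
  qed
  have borel: "(indicator A :: complex \<Rightarrow> complex) \<in> C" if A: "A \<in> sets borel" for A
  proof -
    have b: "sets borel = sigma_sets UNIV (Collect closed :: complex set set)"
      by (simp add: borel_eq_closed)
    show ?thesis
    proof (rule sigma_sets_induct_disjoint[of "Collect closed" UNIV A])
      show "Int_stable (Collect closed :: complex set set)" by (auto simp: Int_stable_def)
      show "A \<in> sigma_sets UNIV (Collect closed)" using A b by simp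
      show "(indicator {} :: complex \<Rightarrow> complex) \<in> C" by (rule closed) simp
    next
      fix A :: "complex set" assume "(indicator A :: complex \<Rightarrow> complex) \<in> C"
      then have "(\<lambda>z. 1 + - 1 * indicator A z :: complex) \<in> C" by (intro add one scale)
      moreover have "(\<lambda>z. 1 + - 1 * indicator A z :: complex) = indicator (UNIV - A)"
        by (auto simp: indicator_def)
      ultimately show "(indicator (UNIV - A) :: complex \<Rightarrow> complex) \<in> C" by simp
    next
      fix A :: "nat \<Rightarrow> complex set"
      assume d: "disjoint_family A" and r: "range A \<subseteq> sigma_sets UNIV (Collect closed)"
        and AC: "\<And>i. (indicator (A i) :: complex \<Rightarrow> complex) \<in> C"
      have [measurable]: "A i \<in> sets borel" for i unfolding b using r by blast
      have part: "(indicator (\<Union>i<n. A i) :: complex \<Rightarrow> complex) \<in> C" for n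
      proof (induction n)
        case 0
        have "(\<Union>i<0. A i) = {}" by simp
        then show ?case using closed[OF closed_empty] by (simp only:)
      next
        case (Suc n)
        have "(indicator (\<Union>i<Suc n. A i) :: complex \<Rightarrow> complex) = (\<lambda>z. indicator (\<Union>i<n. A i) z + indicator (A n) z)"
        proof
          fix z
          have "z \<notin> (\<Union>i<n. A i)" if "z \<in> A n"
          proof
            assume "z \<in> (\<Union>i<n. A i)"
            then obtain i where i: "i < n" "z \<in> A i" by blast
            then have "A i \<inter> A n = {}" by (intro disjoint_family_onD[OF d]) auto
            with i that show False by (simp add: disjoint_iff)
          qed
          then show "(indicator (\<Union>i<Suc n. A i) z :: complex) = indicator (\<Union>i<n. A i) z + indicator (A n) z"
            by (cases "z \<in> A n") (simp_all add: lessThan_Suc indicator_def)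
        qed
        then show ?case using add[OF Suc AC] by simp
      qed
      show "(indicator (\<Union>i. A i) :: complex \<Rightarrow> complex) \<in> C"
      proof (rule bounded_lim[OF part, where B=1])
        show "(indicator (\<Union>i. A i) :: complex \<Rightarrow> complex) \<in> borel_measurable N"
          by (rule meas_borel) measurable
        show "(\<lambda>n. indicator (\<Union>i<n. A i) z :: complex) \<longlonglongrightarrow> indicator (\<Union>i. A i) z" for z
          by (rule LIMSEQ_indicator_UN)
      qed (simp add: indicator_def)
    qed (auto intro: closed)
  qed
  have simple: "s \<in> C" if s: "simple_function N s" for s :: "complex \<Rightarrow> complex"
  proof (rule cong)
    have fin: "finite (s ` sphere 0 1)" using simple_functionD(1)[OF s] sp by simp
    show "s z = (\<Sum>c\<in>s ` sphere 0 1. c * indicator (s -` {c} \<inter> sphere 0 1) z)" if "z \<in> sphere 0 1" for z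
      using sum_level_sets[OF fin that, of "\<lambda>c. c"]
      by (simp add: scaleR_conv_of_real of_real_indicator mult.commute)
    have lC: "(indicator (s -` {c} \<inter> sphere 0 1) :: complex \<Rightarrow> complex) \<in> C" for c
      by (rule borel, rule sets_circle_borel_imp_borel)
        (use simple_functionD(2)[OF s, of "{c}"] sN sp in simp)
    have "(\<lambda>z. \<Sum>c\<in>I. c * indicator (s -` {c} \<inter> sphere 0 1) z) \<in> C" if "finite I" for I
      using that
    proof (induction rule: finite_induct)
      case empty then show ?case using scale[OF one, of 0] by simp
    next
      case (insert c I)
      then show ?case
        using add[OF scale[OF lC[of c], of c] insert.IH] by (simp only: sum.insert[OF insert.hyps])
    qed
    then show "(\<lambda>z. \<Sum>c\<in>s ` sphere 0 1. c * indicator (s -` {c} \<inter> sphere 0 1) z) \<in> C"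
      using fin .
  qed
  show ?thesis
  proof (intro equalityI C subsetI)
    fix f assume f: "f \<in> sq_integrable N"
    then obtain s where "\<And>n. simple_function N (s n)" "(\<lambda>n. fn_norm N (\<lambda>x. s n x - f x)) \<longlonglongrightarrow> 0"
      using simple_functions_dense[OF f] by blast
    then show "f \<in> C" using lim[OF f, of s] simple by blast
  qed
qed

section \<open>The scalar spectral measure\<close>

text \<open>The setting is a unitary operator on \<open>L\<^sup>2\<close> of a finite measure, with its spectral measure and a
  vector. Countable additivity of the scalar measure is strong countable additivity of the
  projections, tested against the vector \<open>v\<close>; nonnegativity holds because \<open>\<langle>E(A) v, v\<rangle>\<close> is the squared
  norm of \<open>E(A) v\<close>.\<close>

locale spectral_vector = finite_measure M for M :: "'a measure" +
  fixes U :: "('a \<Rightarrow> complex) set \<Rightarrow> ('a \<Rightarrow> complex) set"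
    and E :: "complex set \<Rightarrow> ('a \<Rightarrow> complex) set \<Rightarrow> ('a \<Rightarrow> complex) set"
    and v :: "('a \<Rightarrow> complex) set"
  assumes unitary: "unitary_l2 M U"
    and spectral: "is_spectral_measure M U E"
    and v: "v \<in> l2 M"
begin

abbreviation m :: "complex measure" where "m \<equiv> scalar_spectral_measure M E v"

lemma pvm: "projection_valued_measure M E"
  using spectral by (simp add: is_spectral_measure_def)

lemma E_in_l2: "A \<in> sets circle_borel \<Longrightarrow> F \<in> l2 M \<Longrightarrow> E A F \<in> l2 M"
  using pvm by (auto simp: projection_valued_measure_def orth_projection_l2_def l2_linear_on_def)

lemma E_self_adjoint:
  "A \<in> sets circle_borel \<Longrightarrow> F \<in> l2 M \<Longrightarrow> G \<in> l2 M \<Longrightarrow> l2_inner M (E A F) G = l2_inner M F (E A G)"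
  using pvm by (auto simp: projection_valued_measure_def orth_projection_l2_def)

lemma E_Int:
  "A \<in> sets circle_borel \<Longrightarrow> B \<in> sets circle_borel \<Longrightarrow> F \<in> l2 M \<Longrightarrow> E (A \<inter> B) F = E A (E B F)"
  using pvm by (auto simp: projection_valued_measure_def)

lemma E_empty: "F \<in> l2 M \<Longrightarrow> E {} F = l2_zero M"
  and E_circle: "F \<in> l2 M \<Longrightarrow> E (sphere 0 1) F = F"
  using pvm by (auto simp: projection_valued_measure_def)

lemma E_inner_eq_norm: 
  assumes A: "A \<in> sets circle_borel"
  shows "l2_inner M (E A v) v = of_real ((l2_norm M (E A v))\<^sup>2)"
proof -
  have "l2_inner M (E A v) v = l2_inner M (E A (E A v)) v" using E_Int[OF A A v] by simp
  also have "\<dots> = l2_inner M (E A v) (E A v)" by (rule E_self_adjoint[OF A E_in_l2[OF A v] v])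
  finally show ?thesis by (simp add: l2_inner_self)
qed

lemma E_sums:
  assumes A: "range A \<subseteq> sets circle_borel" "disjoint_family A"
  shows "(\<lambda>i. l2_inner M (E (A i) v) v) sums l2_inner M (E (\<Union>i. A i) v) v"
proof -
  have EA: "E (A i) v \<in> l2 M" for i using A v by (intro E_in_l2) auto
  have "limitin (l2_topology M) (\<lambda>n. l2_sum M (\<lambda>i. E (A i) v) {..<n}) (E (\<Union>i. A i) v) sequentially"
    using pvm A v unfolding projection_valued_measure_def by blast
  then have "(\<lambda>n. l2_inner M (l2_sum M (\<lambda>i. E (A i) v) {..<n}) v) \<longlonglongrightarrow> l2_inner M (E (\<Union>i. A i) v) v"
    using EA v by (intro l2_inner_tendsto_left l2_sum_in_l2) (auto simp: l2_limitin_iff)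
  then show ?thesis by (simp add: l2_inner_sum_left EA v sums_def)
qed

lemma sets_m [simp]: "sets m = sets circle_borel"
proof -
  have "sets circle_borel \<subseteq> Pow (sphere 0 1)" using sets.space_closed[of circle_borel] by simp
  then show ?thesis
    using sets.sigma_sets_eq[of circle_borel] by (simp add: scalar_spectral_measure_def)
qed

lemma space_m [simp]: "space m = sphere 0 1"
  using sets_eq_imp_space_eq[OF sets_m] by simp

lemma emeasure_m:
  assumes "A \<in> sets circle_borel"
  shows "emeasure m A = ennreal (Re (l2_inner M (E A v) v))"
  unfolding scalar_spectral_measure_def
proof (rule emeasure_measure_of_sigma)
  show "sigma_algebra (sphere 0 1) (sets circle_borel)"
    using sets.sigma_algebra_axioms[of circle_borel] by simp
  show "positive (sets circle_borel) (\<lambda>A. ennreal (Re (l2_inner M (E A v) v)))"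
    by (simp add: positive_def E_empty l2_inner_zero_left v)
  show "countably_additive (sets circle_borel) (\<lambda>A. ennreal (Re (l2_inner M (E A v) v)))"
  proof (rule countably_additiveI)
    fix A :: "nat \<Rightarrow> complex set"
    assume A: "range A \<subseteq> sets circle_borel" "disjoint_family A"
    show "(\<Sum>i. ennreal (Re (l2_inner M (E (A i) v) v))) = ennreal (Re (l2_inner M (E (\<Union>i. A i) v) v))"
    proof (rule suminf_ennreal_eq)
      show "0 \<le> Re (l2_inner M (E (A i) v) v)" for i
        using A by (subst E_inner_eq_norm) auto
      show "(\<lambda>i. Re (l2_inner M (E (A i) v) v)) sums Re (l2_inner M (E (\<Union>i. A i) v) v)"
        using E_sums[OF A] by (rule sums_Re)
    qed
  qed
qed (rule assms)

lemma finite_m: "finite_measure m"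
  by (rule finite_measureI) (use sets.top[of circle_borel] in \<open>simp add: emeasure_m\<close>)

sublocale m: finite_measure m by (rule finite_m)

lemma inner_E_eq_measure:
  assumes A: "A \<in> sets circle_borel"
  shows "l2_inner M (E A v) v = of_real (measure m A)"
  using E_inner_eq_norm[OF A] emeasure_m[OF A] by (simp add: measure_def)

section \<open>Integrals of simple functions\<close>

abbreviation I :: "(complex \<Rightarrow> complex) \<Rightarrow> ('a \<Rightarrow> complex) set \<Rightarrow> ('a \<Rightarrow> complex) set" where
  "I \<equiv> pvm_simple_integral M E"

abbreviation level :: "(complex \<Rightarrow> complex) \<Rightarrow> complex \<Rightarrow> complex set" where
  "level s c \<equiv> s -` {c} \<inter> sphere 0 1"

lemma level_sets:
  assumes "simple_function circle_borel s"
  shows "finite (s ` sphere 0 1)" "level s c \<in> sets circle_borel"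
  using simple_functionD(1)[OF assms] simple_functionD(2)[OF assms, of "{c}"] by auto

lemma I_in_l2:
  assumes "simple_function circle_borel s" "F \<in> l2 M"
  shows "I s F \<in> l2 M"
  unfolding pvm_simple_integral_def
  by (intro l2_sum_in_l2 l2_scale_in_l2 E_in_l2 level_sets assms)

lemma inner_I_left:
  assumes "simple_function circle_borel s" "F \<in> l2 M" "G \<in> l2 M"
  shows "l2_inner M (I s F) G = (\<Sum>c\<in>s ` sphere 0 1. c * l2_inner M (E (level s c) F) G)"
  unfolding pvm_simple_integral_def
  by (simp add: l2_inner_sum_left l2_inner_scale_left l2_scale_in_l2 E_in_l2 level_sets assms)

lemma inner_I_right:
  assumes "simple_function circle_borel s" "F \<in> l2 M" "G \<in> l2 M"
  shows "l2_inner M F (I s G) = (\<Sum>c\<in>s ` sphere 0 1. cnj c * l2_inner M F (E (level s c) G))"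
  unfolding pvm_simple_integral_def
  by (simp add: l2_inner_sum_right l2_inner_scale_right l2_scale_in_l2 E_in_l2 level_sets assms)

lemma I_one:
  assumes F: "F \<in> l2 M"
  shows "I (\<lambda>z. 1) F = F"
proof -
  have im: "(\<lambda>z. 1::complex) ` sphere (0::complex) 1 = {1}"
    by (auto intro!: image_eqI[of _ _ 1])
  have "l2_scale M 1 F = F" by (simp add: l2_scale_def l2_class_rep F)
  then show ?thesis
    unfolding pvm_simple_integral_def im using F by (simp add: l2_sum_def E_circle l2_class_rep)
qed

text \<open>The inner product \<open>\<langle>E(A) E(B) v, E(C) v\<rangle>\<close> is the measure of \<open>A \<inter> B \<inter> C\<close>, because the projections
  multiply like indicator functions; both sides are then the same sum over the triples of values.
  The third function \<open>p\<close> serves two purposes: \<open>p = 1\<close> shows that \<open>s \<mapsto> I s v\<close> preserves inner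
  products, and \<open>p\<close> tending to the identity gives the action of \<open>U\<close>.\<close>

lemma inner_I_I:
  assumes p: "simple_function circle_borel p" and s: "simple_function circle_borel s"
    and t: "simple_function circle_borel t"
  shows "l2_inner M (I p (I s v)) (I t v) = fn_inner m (\<lambda>z. p z * s z) t"
proof -
  let ?T = "sphere 0 1 :: complex set"
  let ?k = "\<lambda>a b c. measure m (level p a \<inter> (level s b \<inter> level t c)) *\<^sub>R (a * b * cnj c)"
  note lev = level_sets[OF p] level_sets[OF s] level_sets[OF t]
  have lv: "l2_inner M (E (level p a) (E (level s b) v)) (E (level t c) v)
      = of_real (measure m (level p a \<inter> (level s b \<inter> level t c)))" for a b c
  proof -
    have "l2_inner M (E (level p a) (E (level s b) v)) (E (level t c) v)
        = l2_inner M (E (level t c) (E (level p a) (E (level s b) v))) v"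
      by (rule E_self_adjoint[symmetric]) (intro lev E_in_l2 v)+
    also have "E (level t c) (E (level p a) (E (level s b) v)) = E (level t c \<inter> (level p a \<inter> level s b)) v"
      using lev v by (simp add: E_Int E_in_l2 sets.Int)
    also have "level t c \<inter> (level p a \<inter> level s b) = level p a \<inter> (level s b \<inter> level t c)" by blast
    finally show ?thesis using lev by (simp add: inner_E_eq_measure sets.Int)
  qed
  have "l2_inner M (I p (I s v)) (I t v)
      = (\<Sum>a\<in>p ` ?T. a * l2_inner M (I s v) (E (level p a) (I t v)))"
    by (simp add: inner_I_left E_self_adjoint p s t v I_in_l2 lev)
  also have "\<dots> = (\<Sum>a\<in>p ` ?T. a * (\<Sum>b\<in>s ` ?T. b * l2_inner M (E (level p a) (E (level s b) v)) (I t v)))"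
    by (simp add: inner_I_left E_self_adjoint E_in_l2 s t v I_in_l2 lev)
  also have "\<dots> = (\<Sum>a\<in>p ` ?T. \<Sum>b\<in>s ` ?T. \<Sum>c\<in>t ` ?T. ?k a b c)"
    by (simp add: inner_I_right E_in_l2 s t v lev lv sum_distrib_left scaleR_conv_of_real mult_ac)
  finally have lhs: "l2_inner M (I p (I s v)) (I t v) = (\<Sum>a\<in>p ` ?T. \<Sum>b\<in>s ` ?T. \<Sum>c\<in>t ` ?T. ?k a b c)" .
  have leaf: "has_bochner_integral m (\<lambda>z. indicator (level p a \<inter> (level s b \<inter> level t c)) z *\<^sub>R (a * b * cnj c))
      (?k a b c)" for a b c
  proof (intro has_bochner_integral_scaleR_left has_bochner_integral_real_indicator)
    show "level p a \<inter> (level s b \<inter> level t c) \<in> sets m"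
      unfolding sets_m by (rule sets.Int[OF lev(2) sets.Int[OF lev(4) lev(6)]])
  qed (simp add: less_top[symmetric])
  have "has_bochner_integral m (\<lambda>z. \<Sum>a\<in>p ` ?T. \<Sum>b\<in>s ` ?T. \<Sum>c\<in>t ` ?T.
      indicator (level p a \<inter> (level s b \<inter> level t c)) z *\<^sub>R (a * b * cnj c))
      (\<Sum>a\<in>p ` ?T. \<Sum>b\<in>s ` ?T. \<Sum>c\<in>t ` ?T. ?k a b c)"
    by (intro has_bochner_integral_sum leaf)
  then have "(\<integral>z. (\<Sum>a\<in>p ` ?T. \<Sum>b\<in>s ` ?T. \<Sum>c\<in>t ` ?T.
      indicator (level p a \<inter> (level s b \<inter> level t c)) z *\<^sub>R (a * b * cnj c)) \<partial>m)
      = (\<Sum>a\<in>p ` ?T. \<Sum>b\<in>s ` ?T. \<Sum>c\<in>t ` ?T. ?k a b c)"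
    by (rule has_bochner_integral_integral_eq)
  also have "(\<integral>z. (\<Sum>a\<in>p ` ?T. \<Sum>b\<in>s ` ?T. \<Sum>c\<in>t ` ?T.
      indicator (level p a \<inter> (level s b \<inter> level t c)) z *\<^sub>R (a * b * cnj c)) \<partial>m) = (\<integral>z. p z * s z * cnj (t z) \<partial>m)"
  proof (rule Bochner_Integration.integral_cong[OF refl])
    fix z assume "z \<in> space m"
    then have z: "z \<in> ?T" by simp
    have "(\<Sum>a\<in>p ` ?T. \<Sum>b\<in>s ` ?T. \<Sum>c\<in>t ` ?T.
        indicator (level p a \<inter> (level s b \<inter> level t c)) z *\<^sub>R (a * b * cnj c))
      = (\<Sum>a\<in>p ` ?T. indicator (level p a) z *\<^sub>R (\<Sum>b\<in>s ` ?T. indicator (level s b) z *\<^sub>R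
          (\<Sum>c\<in>t ` ?T. indicator (level t c) z *\<^sub>R (a * b * cnj c))))"
      by (simp only: scaleR_sum_right scaleR_scaleR indicator_inter_arith)
    also have "\<dots> = p z * s z * cnj (t z)"
      using z lev by (simp only: sum_level_sets)
    finally show "(\<Sum>a\<in>p ` ?T. \<Sum>b\<in>s ` ?T. \<Sum>c\<in>t ` ?T.
        indicator (level p a \<inter> (level s b \<inter> level t c)) z *\<^sub>R (a * b * cnj c)) = p z * s z * cnj (t z)" .
  qed
  finally show ?thesis unfolding lhs fn_inner_def by simp
qed

lemma simple_function_m: "simple_function m s \<longleftrightarrow> simple_function circle_borel s"
  by (simp add: simple_function_def)

lemma simple_sq_integrable:
  assumes "simple_function circle_borel s"
  shows "s \<in> sq_integrable m"
proof -
  obtain B where "\<forall>z\<in>sphere 0 1. cmod (s z) \<le> B"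
    using finite_imp_bounded[OF level_sets(1)[OF assms]] by (auto simp: bounded_iff)
  moreover have "s \<in> borel_measurable m"
    using borel_measurable_simple_function[of m s] assms by (simp add: simple_function_m)
  ultimately show ?thesis by (intro m.bounded_sq_integrable[of _ B]) auto
qed

lemma inner_preserving_I: "inner_preserving {s. simple_function circle_borel s} m M (\<lambda>s. I s v)"
  unfolding inner_preserving_def
proof (intro conjI ballI subsetI; clarsimp)
  fix s t :: "complex \<Rightarrow> complex"
  assume s: "simple_function circle_borel s" and t: "simple_function circle_borel t"
  show "l2_inner M (I s v) (I t v) = fn_inner m s t"
    using inner_I_I[OF _ s t, of "\<lambda>z. 1"] by (simp add: I_one I_in_l2 s v)
qed (simp_all add: simple_sq_integrable I_in_l2 v)

text \<open>The vector \<open>f(U) v\<close> for a square-integrable \<open>f\<close>, obtained from simple functions by continuous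
  extension.\<close>

definition fun_calc :: "(complex \<Rightarrow> complex) \<Rightarrow> ('a \<Rightarrow> complex) set" where
  "fun_calc = (SOME W. inner_preserving (sq_integrable m) m M W \<and>
     (\<forall>s. simple_function circle_borel s \<longrightarrow> W s = I s v))"

lemma fun_calc: "inner_preserving (sq_integrable m) m M fun_calc"
  and fun_calc_simple: "simple_function circle_borel s \<Longrightarrow> fun_calc s = I s v"
proof -
  have "\<exists>s. (\<forall>n. s n \<in> {s. simple_function circle_borel s}) \<and> (\<lambda>n. fn_norm m (\<lambda>z. s n z - f z)) \<longlonglongrightarrow> 0"
    if "f \<in> sq_integrable m" for f
    using simple_functions_dense[OF that] by (auto simp: simple_function_m)
  from extend_isometry[OF inner_preserving_I this]
  have "\<exists>W. inner_preserving (sq_integrable m) m M W \<and>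
      (\<forall>s. simple_function circle_borel s \<longrightarrow> W s = I s v)" by simp
  from someI_ex[OF this]
  have "inner_preserving (sq_integrable m) m M fun_calc \<and>
      (\<forall>s. simple_function circle_borel s \<longrightarrow> fun_calc s = I s v)" unfolding fun_calc_def .
  then show "inner_preserving (sq_integrable m) m M fun_calc"
    and "simple_function circle_borel s \<Longrightarrow> fun_calc s = I s v" by auto
qed

lemma fun_calc_in_l2: "f \<in> sq_integrable m \<Longrightarrow> fun_calc f \<in> l2 M"
  using fun_calc by (auto simp: inner_preserving_def)

lemma fun_calc_inner:
  "f \<in> sq_integrable m \<Longrightarrow> g \<in> sq_integrable m \<Longrightarrow> l2_inner M (fun_calc f) (fun_calc g) = fn_inner m f g"
  using fun_calc by (auto simp: inner_preserving_def)

lemma fun_calc_tendsto: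
  assumes "f \<in> sq_integrable m" "\<And>n. s n \<in> sq_integrable m" "(\<lambda>n. fn_norm m (\<lambda>z. s n z - f z)) \<longlonglongrightarrow> 0"
  shows "(\<lambda>n. l2_dist M (fun_calc (s n)) (fun_calc f)) \<longlonglongrightarrow> 0"
  using assms by (simp add: inner_preserving_dist[OF fun_calc])

lemma fun_calc_one: "fun_calc (\<lambda>z. 1) = v"
  by (simp add: fun_calc_simple I_one v)

section \<open>The action of the operator and the cyclic subspace\<close>

lemma U_in_l2: "F \<in> l2 M \<Longrightarrow> U F \<in> l2 M"
  using unitary by (auto simp: unitary_l2_def l2_linear_on_def)

lemma U_inner: "F \<in> l2 M \<Longrightarrow> G \<in> l2 M \<Longrightarrow> l2_inner M (U F) (U G) = l2_inner M F G"
  using unitary by (auto simp: unitary_l2_def)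

lemma U_dist:
  assumes "F \<in> l2 M" "G \<in> l2 M"
  shows "l2_dist M (U F) (U G) = l2_dist M F G"
proof -
  have "complex_of_real ((l2_dist M (U F) (U G))\<^sup>2) = of_real ((l2_dist M F G)\<^sup>2)"
    using assms by (simp only: l2_dist_sq U_in_l2 U_inner)
  then have "(l2_dist M (U F) (U G))\<^sup>2 = (l2_dist M F G)\<^sup>2" by (simp only: of_real_eq_iff)
  then show ?thesis by (simp add: l2_dist_eq)
qed

lemma fn_norm_m_cong:
  assumes "\<And>z. z \<in> sphere 0 1 \<Longrightarrow> cmod (f z) = cmod (g z)"
  shows "fn_norm m f = fn_norm m g"
  unfolding fn_norm_def
  using assms Bochner_Integration.integral_cong[of m m "\<lambda>x. (cmod (f x))\<^sup>2" "\<lambda>x. (cmod (g x))\<^sup>2"] by simp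

lemma sq_integrable_mult_unimodular:
  assumes f: "f \<in> sq_integrable m" and h: "h \<in> borel_measurable borel"
    and h1: "\<And>z. z \<in> sphere 0 1 \<Longrightarrow> cmod (h z) = 1"
  shows "(\<lambda>z. h z * f z) \<in> sq_integrable m"
proof -
  note [measurable] = sq_integrableD(1)[OF f]
  have "h \<in> borel_measurable circle_borel"
    using h by (simp add: circle_borel_def measurable_restrict_space1)
  then have [measurable]: "h \<in> borel_measurable m"
    using measurable_cong_sets[OF sets_m refl] by blast
  have "integrable m (\<lambda>z. (cmod (h z * f z))\<^sup>2) \<longleftrightarrow> integrable m (\<lambda>z. (cmod (f z))\<^sup>2)"
    by (rule Bochner_Integration.integrable_cong) (simp_all add: norm_mult h1)
  then show ?thesis using sq_integrableD(2)[OF f] by (simp add: sq_integrable_def)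
qed

lemma sq_integrable_mult_z:
  assumes "f \<in> sq_integrable m"
  shows "(\<lambda>z. z * f z) \<in> sq_integrable m" "(\<lambda>z. cnj z * f z) \<in> sq_integrable m"
  using sq_integrable_mult_unimodular[OF assms, of "\<lambda>z. z"] sq_integrable_mult_unimodular[OF assms, of cnj]
    borel_measurable_cnj[of "\<lambda>z. z" borel] by simp_all

text \<open>Here the convergence of the simple integrals to \<open>U\<close> enters. The approximants of the identity
  converge uniformly, hence after finitely many terms the errors are dominated by \<open>s\<close>.\<close>

lemma inner_U_I:
  assumes s: "simple_function circle_borel s" and t: "simple_function circle_borel t"
  shows "l2_inner M (U (I s v)) (I t v) = fn_inner m (\<lambda>z. z * s z) t"
proof -
  obtain p where p: "\<And>n. simple_function circle_borel (p n)"
    and unif: "uniform_limit (sphere 0 1) p (\<lambda>z. z) sequentially"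
    and lim: "\<And>F. F \<in> l2 M \<Longrightarrow> limitin (l2_topology M) (\<lambda>n. I (p n) F) (U F) sequentially"
    using spectral unfolding is_spectral_measure_def has_pvm_integral_def by auto
  obtain k where "\<forall>n\<ge>k. \<forall>z\<in>sphere 0 1. dist (p n z) z < 1"
    using uniform_limitD[OF unif, of 1] unfolding eventually_sequentially by auto
  then have k: "dist (p n z) z < 1" if "k \<le> n" "z \<in> sphere 0 1" for n z using that by blast
  have Is: "I s v \<in> l2 M" "I t v \<in> l2 M" using s t v by (auto intro: I_in_l2)
  have sq: "s \<in> sq_integrable m" "t \<in> sq_integrable m" using s t by (auto intro: simple_sq_integrable)
  have pm: "simple_function circle_borel (\<lambda>z. p n z * s z)" for n using p s by (rule simple_function_mult)
  have "(\<lambda>n. l2_inner M (I (p (n + k)) (I s v)) (I t v)) \<longlonglongrightarrow> l2_inner M (U (I s v)) (I t v)"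
  proof (rule LIMSEQ_ignore_initial_segment, rule l2_inner_tendsto_left)
    show "(\<lambda>n. l2_dist M (I (p n) (I s v)) (U (I s v))) \<longlonglongrightarrow> 0"
      using lim[OF Is(1)] by (simp add: l2_limitin_iff)
  qed (use Is p in \<open>auto intro: I_in_l2 U_in_l2\<close>)
  moreover have "(\<lambda>n. fn_inner m (\<lambda>z. p (n + k) z * s z) t) \<longlonglongrightarrow> fn_inner m (\<lambda>z. z * s z) t"
  proof (rule fn_inner_tendsto)
    show "(\<lambda>n. fn_norm m (\<lambda>z. p (n + k) z * s z - z * s z)) \<longlonglongrightarrow> 0"
    proof (rule fn_norm_dominated)
      show "(\<lambda>z. z * s z) \<in> borel_measurable m" using sq_integrable_mult_z(1)[OF sq(1)] by (rule sq_integrableD)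
      show "(\<lambda>z. p (n + k) z * s z) \<in> borel_measurable m" for n
        using simple_sq_integrable[OF pm] by (rule sq_integrableD)
      show "integrable m (\<lambda>z. (cmod (s z))\<^sup>2)" using sq(1) by (rule sq_integrableD)
      fix z assume "z \<in> space m"
      then have z: "z \<in> sphere 0 1" by simp
      have "(\<lambda>n. p (n + k) z) \<longlonglongrightarrow> z"
        using tendsto_uniform_limitI[OF unif z] by (rule LIMSEQ_ignore_initial_segment)
      then show "(\<lambda>n. p (n + k) z * s z) \<longlonglongrightarrow> z * s z" by (intro tendsto_intros)
      fix n
      have "cmod (p (n + k) z - z) \<le> 1" using k[of "n + k" z] z by (simp add: dist_norm)
      then have "cmod (p (n + k) z - z) * cmod (s z) \<le> cmod (s z)"
        by (intro mult_left_le_one_le) auto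
      then have "cmod (p (n + k) z * s z - z * s z) \<le> cmod (s z)"
        by (simp only: left_diff_distrib[symmetric] norm_mult)
      then show "(cmod (p (n + k) z * s z - z * s z))\<^sup>2 \<le> (cmod (s z))\<^sup>2" by (intro power_mono) auto
    qed
    show "(\<lambda>n. fn_norm m (\<lambda>z. t z - t z)) \<longlonglongrightarrow> 0" by (simp add: fn_norm_def)
  qed (use sq simple_sq_integrable[OF pm] in \<open>auto intro: sq_integrable_mult_z\<close>)
  ultimately show ?thesis
    using inner_I_I[OF p s t] by (simp add: LIMSEQ_unique)
qed

text \<open>In the model \<open>L\<^sup>2(m)\<close> the operator acts as multiplication by \<open>z\<close>. By the previous lemma and
  density, both sides have the same inner product with every \<open>g(U) v\<close>; the right-hand side is itself
  of this form, and both sides have the same norm since \<open>z\<close> is unimodular.\<close>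

lemma U_fun_calc:
  assumes f: "f \<in> sq_integrable m"
  shows "U (fun_calc f) = fun_calc (\<lambda>z. z * f z)"
proof -
  have ip: "l2_inner M (U (fun_calc f)) (fun_calc g) = fn_inner m (\<lambda>z. z * f z) g" if g: "g \<in> sq_integrable m" for g
  proof -
    obtain s where s: "\<And>n. simple_function circle_borel (s n)" "\<And>n. s n \<in> sq_integrable m"
      and sl: "(\<lambda>n. fn_norm m (\<lambda>z. s n z - f z)) \<longlonglongrightarrow> 0"
      using simple_functions_dense[OF f] by (auto simp: simple_function_m)
    obtain t where t: "\<And>n. simple_function circle_borel (t n)" "\<And>n. t n \<in> sq_integrable m"
      and tl: "(\<lambda>n. fn_norm m (\<lambda>z. t n z - g z)) \<longlonglongrightarrow> 0"
      using simple_functions_dense[OF g] by (auto simp: simple_function_m)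
    have "(\<lambda>n. l2_inner M (U (fun_calc (s n))) (fun_calc (t n))) \<longlonglongrightarrow> l2_inner M (U (fun_calc f)) (fun_calc g)"
    proof (rule l2_inner_tendsto)
      show "(\<lambda>n. l2_dist M (U (fun_calc (s n))) (U (fun_calc f))) \<longlonglongrightarrow> 0"
        using fun_calc_tendsto[OF f s(2) sl] by (simp add: U_dist fun_calc_in_l2 f s)
      show "(\<lambda>n. l2_dist M (fun_calc (t n)) (fun_calc g)) \<longlonglongrightarrow> 0" by (rule fun_calc_tendsto[OF g t(2) tl])
    qed (simp_all add: U_in_l2 fun_calc_in_l2 f g s t)
    moreover have "(\<lambda>n. fn_inner m (\<lambda>z. z * s n z) (t n)) \<longlonglongrightarrow> fn_inner m (\<lambda>z. z * f z) g"
    proof (rule fn_inner_tendsto)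
      have "fn_norm m (\<lambda>z. z * s n z - z * f z) = fn_norm m (\<lambda>z. s n z - f z)" for n
        by (rule fn_norm_m_cong) (simp add: right_diff_distrib[symmetric] norm_mult)
      then show "(\<lambda>n. fn_norm m (\<lambda>z. z * s n z - z * f z)) \<longlonglongrightarrow> 0" using sl by simp
    qed (simp_all add: sq_integrable_mult_z f g s t tl)
    ultimately show ?thesis
      using inner_U_I[OF s(1) t(1)] by (simp add: fun_calc_simple s t LIMSEQ_unique)
  qed
  have zz: "fn_inner m (\<lambda>z. z * f z) (\<lambda>z. z * f z) = fn_inner m f f"
    unfolding fn_inner_self using fn_norm_m_cong[of "\<lambda>z. z * f z" f] by (simp add: norm_mult)
  note zf = sq_integrable_mult_z(1)[OF f]
  show ?thesis
    by (rule l2_eqI[where M=M and c="fn_inner m f f"])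
      (simp_all add: U_in_l2 U_inner fun_calc_in_l2 fun_calc_inner ip zz zf f)
qed

text \<open>On the circle \<open>cnj z\<close> is the inverse of \<open>z\<close>.\<close>

lemma U_inv_fun_calc:
  assumes f: "f \<in> sq_integrable m"
  shows "inv_into (l2 M) U (fun_calc f) = fun_calc (\<lambda>z. cnj z * f z)"
proof (rule inv_into_f_eq)
  note cf = sq_integrable_mult_z(2)[OF f]
  show "inj_on U (l2 M)" using unitary by (simp add: unitary_l2_def bij_betw_def)
  show "fun_calc (\<lambda>z. cnj z * f z) \<in> l2 M" by (rule fun_calc_in_l2[OF cf])
  have z1: "z * (cnj z * f z) = f z" if "cmod z = 1" for z
    using that complex_norm_square[of z] by (simp add: mult.assoc[symmetric])
  have "U (fun_calc (\<lambda>z. cnj z * f z)) = fun_calc (\<lambda>z. z * (cnj z * f z))" by (rule U_fun_calc[OF cf])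
  also have "\<dots> = fun_calc f"
  proof (rule inner_preserving_eqI[OF fun_calc])
    show "(\<lambda>z. z * (cnj z * f z)) \<in> sq_integrable m" by (rule sq_integrable_mult_z(1)[OF cf])
    have "fn_norm m (\<lambda>z. z * (cnj z * f z) - f z) = fn_norm m (\<lambda>z. 0)"
      by (rule fn_norm_m_cong) (simp add: z1)
    then show "fn_norm m (\<lambda>z. z * (cnj z * f z) - f z) = 0" by (simp add: fn_norm_def)
  qed (rule f)
  finally show "U (fun_calc (\<lambda>z. cnj z * f z)) = fun_calc f" .
qed

text \<open>The range is closed, invariant and contains \<open>v\<close>, hence contains the cyclic subspace. If \<open>S\<close> is a
  closed subspace that contains \<open>v\<close> and is invariant, then the functions sent into \<open>S\<close> satisfy
  the hypotheses of the density lemma.\<close>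

lemma cyclic_subspace_eq_range: "cyclic_subspace M U v = fun_calc ` sq_integrable m"
proof
  have closed: "closed_l2_subspace M (fun_calc ` sq_integrable m)"
    by (rule inner_preserving_range_closed[OF finite_m fun_calc])
  have one: "(\<lambda>z. 1) \<in> sq_integrable m" by (rule m.bounded_sq_integrable[of _ 1]) auto
  have "U ` fun_calc ` sq_integrable m \<subseteq> fun_calc ` sq_integrable m"
    and "inv_into (l2 M) U ` fun_calc ` sq_integrable m \<subseteq> fun_calc ` sq_integrable m"
    using U_fun_calc U_inv_fun_calc sq_integrable_mult_z by auto
  moreover have "v \<in> fun_calc ` sq_integrable m" using fun_calc_one one by (metis imageI)
  ultimately show "cyclic_subspace M U v \<subseteq> fun_calc ` sq_integrable m"
    unfolding cyclic_subspace_def using closed by blast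
  show "fun_calc ` sq_integrable m \<subseteq> cyclic_subspace M U v"
    unfolding cyclic_subspace_def
  proof (rule Inter_greatest, clarify)
    fix S f assume S: "closed_l2_subspace M S" "v \<in> S" "U ` S \<subseteq> S" "inv_into (l2 M) U ` S \<subseteq> S"
      and f: "f \<in> sq_integrable m"
    let ?C = "{f \<in> sq_integrable m. fun_calc f \<in> S}"
    have "?C = sq_integrable m"
    proof (rule sq_integrable_circle_dense[OF finite_m sets_m])
      show "(\<lambda>z. f z + g z) \<in> ?C" if "f \<in> ?C" "g \<in> ?C" for f g
        using that S(1) by (auto simp: inner_preserving_add[OF fun_calc] sq_integrable_add closed_l2_subspace_def)
      show "(\<lambda>z. c * f z) \<in> ?C" if "f \<in> ?C" for c f
        using that S(1) by (auto simp: inner_preserving_scale[OF fun_calc] sq_integrable_scale closed_l2_subspace_def)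
      show "f \<in> ?C" if f: "f \<in> sq_integrable m" and s: "\<And>n. s n \<in> ?C"
        and l: "(\<lambda>n. fn_norm m (\<lambda>z. s n z - f z)) \<longlonglongrightarrow> 0" for f s
      proof -
        have "\<forall>X F. (\<forall>n. X n \<in> S) \<longrightarrow> F \<in> l2 M \<longrightarrow> (\<lambda>n. l2_dist M (X n) F) \<longlonglongrightarrow> 0 \<longrightarrow> F \<in> S"
          using S(1) unfolding closed_l2_subspace_def l2_closedin_iff by (elim conjE)
        note seq = this[rule_format, of "\<lambda>n. fun_calc (s n)"]
        have sl: "(\<lambda>n. l2_dist M (fun_calc (s n)) (fun_calc f)) \<longlonglongrightarrow> 0"
          by (rule fun_calc_tendsto[OF f _ l]) (use s in simp)
        have "fun_calc f \<in> S" by (rule seq[OF _ fun_calc_in_l2[OF f] sl]) (use s in simp)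
        then show ?thesis using f by simp
      qed
      show "(\<lambda>z. 1) \<in> ?C" using one fun_calc_one S(2) by simp
      show "(\<lambda>z. z * f z) \<in> ?C" if "f \<in> ?C" for f
        using that S(3) U_fun_calc[of f] sq_integrable_mult_z(1)[of f] by (auto simp: image_subset_iff)
      show "(\<lambda>z. cnj z * f z) \<in> ?C" if "f \<in> ?C" for f
        using that S(4) U_inv_fun_calc[of f] sq_integrable_mult_z(2)[of f] by (auto simp: image_subset_iff)
    qed auto
    then show "fun_calc f \<in> S" using f by blast
  qed
qed

theorem cyclic_isometric_iso: "\<exists>T. l2_isometric_iso M (cyclic_subspace M U v) m T"
  unfolding cyclic_subspace_eq_range by (rule inner_preserving_induces_iso[OF fun_calc])

end

section \<open>The operator that scales the spectrum by 5\<close>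

theorem theorem3p4:
  fixes U :: "(real \<Rightarrow> complex) set \<Rightarrow> (real \<Rightarrow> complex) set"
    and E :: "complex set \<Rightarrow> (real \<Rightarrow> complex) set \<Rightarrow> (real \<Rightarrow> complex) set"
    and v :: "(real \<Rightarrow> complex) set"
  assumes "is_scaling_by_5 U"
    and "is_spectral_measure mu_quarter U E"
    and "v \<in> l2 mu_quarter"
    and "l2_norm mu_quarter v = 1"
  shows "\<exists>T. l2_isometric_iso mu_quarter (cyclic_subspace mu_quarter U v)
               (scalar_spectral_measure mu_quarter E v) T"
proof -
  interpret prob_space mu_quarter
    using quarter_invariant_mu_quarter by (simp add: quarter_invariant_def)
  interpret spectral_vector mu_quarter U E v
    by unfold_locales (use assms in \<open>auto simp: is_scaling_by_5_def\<close>)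
  show ?thesis by (rule cyclic_isometric_iso)
qed

end
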